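(* Let $p$ be a prime, $m$ a positive integer, $q=p^m$ with $q>2$, $n=q^2+1$. Let $\mathcal{C}$ be either (i) for $\lambda\in\mathbb{F}_{q^2}^*$ of order $r$ with $r\mid(q+1)$, $\nu_2(r)=\nu_2(q+1)$, the $\lambda$-constacyclic code $\mathcal{C}(1,q^2+q+1)$ of length $n$ over $\mathbb{F}_{q^2}$ with check polynomial $(x-\delta)(x-\delta^{q^2})(x-\delta^{q^2+q+1})(x-\delta^{q^4+q^3+q^2})$, or (ii) for $\lambda\in\mathbb{F}_{q^2}^*$ of order $r$ with $r\mid(q-1)$, $\nu_2(r)=\nu_2(q-1)$, the $\lambda$-constacyclic code $\mathcal{C}(1,q^2-q+1)$ of length $n$ over $\mathbb{F}_{q^2}$ with check polynomial $(x-\delta)(x-\delta^{q^2})(x-\delta^{q^2-q+1})(x-\delta^{q^4-q^3+q^2})$; here $\delta\in\mathbb{F}_{q^4}$ is a primitive $rn$-th root of unity with $\delta^n=\lambda$. Then the dual code $\mathcal{C}^\perp$, viewed as an LRC over $\mathbb{F}_{q^2}$ with its (minimum) locality, is both distance-optimal and dimension-optimal.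
   Context: $\nu_2$ is the $2$-adic valuation. A coordinate $i$ of a linear code has locality $r_l$ if in every codeword the $i$-th symbol is a function of some fixed $r_l$ other symbols; a code has locality $r_l$ if every coordinate has locality at most $r_l$. An $(n,k,d,Q;r_l)$-LRC is a linear $[n,k,d]$ code over $\mathbb{F}_Q$ with locality $r_l$. It is distance-optimal if $d=n-k-\lceil k/r_l\rceil+2$ (Singleton-like bound), and dimension-optimal if $k=\min_{t\in\mathbb{Z}_{\ge0}}\{t r_l+k^{(Q)}_{\mathrm{opt}}(n-t(r_l+1),d)\}$ (Cadambe–Mazumdar bound), where $k^{(Q)}_{\mathrm{opt}}(N,d)$ is the largest dimension of a $Q$-ary linear code of length $N$ and minimum distance $d$. *)

theory Defs
  imports "HOL-Computational_Algebra.Computational_Algebra" "HOL-Library.Function_Algebras" "HOL-Library.Cardinality"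
begin

definition words :: "nat \<Rightarrow> ('a::zero) set \<Rightarrow> (nat \<Rightarrow> 'a) set" where
  "words N A = {c. (\<forall>i<N. c i \<in> A) \<and> (\<forall>i\<ge>N. c i = 0)}"

definition vscale :: "'a::field \<Rightarrow> (nat \<Rightarrow> 'a) \<Rightarrow> (nat \<Rightarrow> 'a)" where
  "vscale a v = (\<lambda>i. a * v i)"

interpretation vs: vector_space "vscale :: 'a::field \<Rightarrow> (nat \<Rightarrow> 'a) \<Rightarrow> _"
  by unfold_locales (auto simp: vscale_def algebra_simps)

definition linear_code :: "nat \<Rightarrow> (nat \<Rightarrow> 'a::field) set \<Rightarrow> bool" where
  "linear_code N C \<longleftrightarrow> C \<subseteq> words N UNIV \<and> vs.subspace C"

definition code_dim :: "(nat \<Rightarrow> 'a::field) set \<Rightarrow> nat" where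
  "code_dim C = vs.dim C"

definition hweight :: "nat \<Rightarrow> (nat \<Rightarrow> 'a::zero) \<Rightarrow> nat" where
  "hweight N c = card {i. i < N \<and> c i \<noteq> 0}"

definition min_dist :: "nat \<Rightarrow> (nat \<Rightarrow> 'a::zero) set \<Rightarrow> nat" where
  "min_dist N C = Min {hweight N c | c. c \<in> C \<and> c \<noteq> 0}"

definition dual_code :: "nat \<Rightarrow> (nat \<Rightarrow> 'a::field) set \<Rightarrow> (nat \<Rightarrow> 'a) set" where
  "dual_code N C = {x \<in> words N UNIV. \<forall>c\<in>C. (\<Sum>i<N. x i * c i) = 0}"

definition coord_locality :: "nat \<Rightarrow> (nat \<Rightarrow> 'a) set \<Rightarrow> nat \<Rightarrow> nat \<Rightarrow> bool" where
  "coord_locality N C i r \<longleftrightarrow>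
     (\<exists>S. S \<subseteq> {0..<N} - {i} \<and> card S = r \<and>
          (\<exists>f. \<forall>c\<in>C. c i = f (\<lambda>j. if j \<in> S then c j else undefined)))"

definition has_locality :: "nat \<Rightarrow> (nat \<Rightarrow> 'a) set \<Rightarrow> nat \<Rightarrow> bool" where
  "has_locality N C r \<longleftrightarrow> (\<forall>i<N. \<exists>r'\<le>r. coord_locality N C i r')"

definition locality :: "nat \<Rightarrow> (nat \<Rightarrow> 'a) set \<Rightarrow> nat" where
  "locality N C = (LEAST r. has_locality N C r)"

text \<open>Singleton-like bound: d = n - k - ceil(k/r) + 2.\<close>
definition distance_optimal :: "nat \<Rightarrow> nat \<Rightarrow> nat \<Rightarrow> nat \<Rightarrow> bool" where
  "distance_optimal n k d r \<longleftrightarrow>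
     int d = int n - int k - \<lceil>real k / real r\<rceil> + 2"

text \<open>k_opt over the field type 'a (of size Q = CARD('a)): the largest dimension of a
  linear code of length N over 'a with minimum distance d (i.e. all nonzero codewords
  have weight at least d; the zero code is allowed and has dimension 0).\<close>
definition kopt :: "'a::{field,finite} itself \<Rightarrow> nat \<Rightarrow> nat \<Rightarrow> nat" where
  "kopt _ N d = Max {code_dim C | C :: (nat \<Rightarrow> 'a) set.
        linear_code N C \<and> (\<forall>c\<in>C. c \<noteq> 0 \<longrightarrow> hweight N c \<ge> d)}"

text \<open>Cadambe--Mazumdar bound (terms with n - t(r+1) < 0 are dropped).\<close>
definition dimension_optimal :: "'a::{field,finite} itself \<Rightarrow> nat \<Rightarrow> nat \<Rightarrow> nat \<Rightarrow> nat \<Rightarrow> bool" where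
  "dimension_optimal T n k d r \<longleftrightarrow>
     k = Min {t * r + kopt T (n - t * (r + 1)) d | t. t * (r + 1) \<le> n}"

definition field_emb :: "('a::field \<Rightarrow> 'b::field) \<Rightarrow> bool" where
  "field_emb e \<longleftrightarrow> inj e \<and> e 1 = 1 \<and> (\<forall>x y. e (x + y) = e x + e y) \<and> (\<forall>x y. e (x * y) = e x * e y)"

definition has_order :: "'a::monoid_mult \<Rightarrow> nat \<Rightarrow> bool" where
  "has_order x k \<longleftrightarrow> 0 < k \<and> x ^ k = 1 \<and> (\<forall>j. 0 < j \<and> j < k \<longrightarrow> x ^ j \<noteq> 1)"

definition check_poly :: "'b::field \<Rightarrow> nat list \<Rightarrow> 'b poly" where
  "check_poly \<delta> es = prod_list (map (\<lambda>e. [:- (\<delta> ^ e), 1:]) es)"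

definition constacyclic_code_check ::
  "('a::field \<Rightarrow> 'b::field) \<Rightarrow> nat \<Rightarrow> 'a \<Rightarrow> 'b poly \<Rightarrow> (nat \<Rightarrow> 'a) set" where
  "constacyclic_code_check emb N lam h =
     {c \<in> words N UNIV.
        (monom 1 N - [:emb lam:]) dvd ((\<Sum>i<N. monom (emb (c i)) i) * h)}"

end

theory Submission
  imports Defs
begin

text \<open>Write \<open>e = q\<^sup>2 \<plusminus> q + 1\<close> and \<open>\<alpha> = \<delta> ^ - 1\<close>. By Delsarte's description of subfield subcodes, the dual
  consists of the words \<open>x\<close> over \<open>F\<^bsub>q\<^sup>2\<^esub>\<close> with \<open>\<Sum> x\<^sub>i \<alpha> ^ i = \<Sum> x\<^sub>i \<alpha> ^ (e i) = 0\<close>. The condition on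
  the order of \<open>\<lambda>\<close> makes \<open>\<alpha> ^ e\<close>, up to rescaling the coordinates by suitable \<open>s\<^sub>i\<close> in \<open>F\<^bsub>q\<^sup>2\<^esub>\<close>
  (Hilbert 90), an odd Frobenius power of \<open>\<alpha>\<close>. With \<open>\<beta>\<^sub>i = s\<^sub>i \<alpha> ^ i\<close> the dual is therefore
  monomially equivalent to a code defined over \<open>F\<^bsub>q\<^esub>\<close>, whose parity check matrix has the columns
  \<open>\<beta>\<^sub>i\<close> in \<open>F\<^bsub>q\<^sup>4\<^esub> = F\<^bsub>q\<^esub>\<^sup>4\<close>. As the norm \<open>\<beta>\<^sub>i ^ (q\<^sup>2 + 1)\<close> lies in \<open>F\<^bsub>q\<^esub>\<close>, these are the \<open>q\<^sup>2 + 1\<close> points of an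
  elliptic quadric in \<open>PG(3, q)\<close>: no three are collinear, and every plane through two of them
  contains exactly \<open>q + 1\<close>. Hence \<open>k = q\<^sup>2 - 3\<close>, \<open>d = 4\<close> and the locality is \<open>q\<^sup>2 - q - 1\<close>. The
  Cadambe--Mazumdar bound is attained at \<open>t = 1\<close>, where shortening the dual to a plane section
  gives \<open>k\<^sub>o\<^sub>p\<^sub>t (q + 1, 4) = q - 2\<close>.\<close>

section \<open>Frobenius and the quadratic form\<close>

lemma finite_field_power_card:
  fixes x :: "'b::{field,finite}"
  shows "x ^ CARD('b) = x"
proof (cases "x = 0")
  case False
  have "x * (\<Prod>y\<in>UNIV-{0}. x * y) = x * x ^ (CARD('b) - 1) * \<Prod>(UNIV-{0})"
    by (simp add: prod.distrib mult_ac)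
  also have "x * x ^ (CARD('b) - 1) = x ^ CARD('b)"
    using finite_UNIV_card_ge_0[where ?'a = 'b] by (simp flip: power_Suc)
  also have "(\<Prod>y\<in>UNIV-{0}. x * y) = (\<Prod>y\<in>UNIV-{0}. y)"
    by (rule prod.reindex_bij_witness[of _ "\<lambda>y. y / x" "\<lambda>y. x * y"]) (use False in auto)
  finally show ?thesis
    by simp
qed (simp add: finite_UNIV_card_ge_0)

lemma CHAR_finite_field:
  assumes "prime p" and "CARD('b::{field,finite}) = p ^ k"
  shows "CHAR('b) = p"
proof -
  have "(\<Sum>y\<in>(UNIV::'b set). y + 1) = (\<Sum>y\<in>UNIV. y)"
    by (rule sum.reindex_bij_witness[of _ "\<lambda>y. y - 1" "\<lambda>y. y + 1"]) auto
  hence "of_nat CARD('b) = (0::'b)"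
    by (simp add: sum.distrib)
  hence "CHAR('b) dvd p ^ k"
    unfolding of_nat_eq_0_iff_char_dvd assms(2) .
  moreover have "prime CHAR('b)"
    by (intro prime_CHAR_semidom finite_imp_CHAR_pos) simp
  ultimately show ?thesis
    using assms(1) prime_dvd_power primes_dvd_imp_eq by blast
qed

text \<open>The polynomial u X^d + v X has at most \<open>d\<close> roots. With \<open>d\<close> a
  power of \<open>q\<close> this bounds fixed fields and yields elements of nonzero trace.\<close>

lemma exists_not_root_binomial:
  fixes u v :: "'b::field"
  assumes "u \<noteq> 0" "1 < d" "finite A" "d < card A"
  shows "\<exists>c\<in>A. u * c ^ d + v * c \<noteq> 0"
proof (rule ccontr)
  assume *: "\<not> ?thesis"
  let ?p = "monom u d + monom v 1"
  have "coeff ?p d \<noteq> 0"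
    using assms by simp
  hence nz: "?p \<noteq> 0"
    by (metis coeff_0)
  have "A \<subseteq> {c. poly ?p c = 0}"
    using * by (auto simp: poly_monom)
  hence "card A \<le> card {c. poly ?p c = 0}"
    using nz by (intro card_mono poly_roots_finite)
  also have "\<dots> \<le> degree ?p"
    using nz by (rule card_poly_roots_bound)
  also have "\<dots> \<le> d"
    using assms by (intro degree_add_le) (auto intro: order.trans[OF degree_monom_le])
  finally show False
    using assms by simp
qed

lemma card_roots_of_unity_le:
  assumes "0 < k"
  shows "card {x::'b::{field,finite}. x ^ k = 1} \<le> k"
proof -
  let ?p = "monom (1::'b) k - 1"
  have "coeff ?p k \<noteq> 0"
    using assms by simp
  hence nz: "?p \<noteq> 0"
    by (metis coeff_0)
  have "{x. poly ?p x = 0} = {x. x ^ k = 1}"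
    by (auto simp: poly_monom)
  thus ?thesis
    using card_poly_roots_bound[OF nz] degree_diff_le[of "monom (1::'b) k" k 1]
    by (simp add: degree_monom_le)
qed

text \<open>That \<open>q\<close> is a prime power enters only through additivity of the
  \<open>q\<close>-th power; the geometry is developed from this and the field size.\<close>

locale quartic_frobenius =
  fixes ty :: "'b::{field,finite} itself" and q :: nat
  assumes q_gt2: "2 < q"
    and card_field: "CARD('b) = q ^ 4"
    and frobenius_add: "\<And>x y::'b. (x + y) ^ q = x ^ q + y ^ q"
begin

definition frob :: "'b \<Rightarrow> 'b" where
  "frob x = x ^ q"

lemma frob_0 [simp]: "frob 0 = 0"
  and frob_1 [simp]: "frob 1 = 1"
  and frob_add [simp]: "frob (x + y) = frob x + frob y"
  and frob_mult [simp]: "frob (x * y) = frob x * frob y"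
  and frob_divide [simp]: "frob (x / y) = frob x / frob y"
  and frob_inverse [simp]: "frob (inverse x) = inverse (frob x)"
  and frob_power: "frob (x ^ k) = frob x ^ k"
  and frob_eq_0_iff [simp]: "frob x = 0 \<longleftrightarrow> x = 0"
  using q_gt2
  by (auto simp: frob_def frobenius_add power_mult_distrib power_divide power_inverse
      mult.commute simp flip: power_mult)

lemma frob_minus [simp]: "frob (- x) = - frob x"
  using frob_add[of x "- x"] by (simp add: eq_neg_iff_add_eq_0 add.commute)

lemma frob_diff [simp]: "frob (x - y) = frob x - frob y"
  using frob_add[of x "- y"] by simp

lemma frob_sum: "frob (sum f A) = (\<Sum>i\<in>A. frob (f i))"
  by (induction A rule: infinite_finite_induct) auto

lemma frob_funpow: "(frob ^^ k) x = x ^ (q ^ k)"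
  by (induction k) (auto simp: frob_def mult.commute simp flip: power_mult)

lemma frob4 [simp]: "frob (frob (frob (frob x))) = x"
  using frob_funpow[of 4 x] finite_field_power_card[of x]
  by (simp add: card_field numeral_eq_Suc)

lemma frob_inject [simp]: "frob x = frob y \<longleftrightarrow> x = y"
  by (metis frob4)

lemma frob2_power: "frob (frob x) = x ^ (q ^ 2)"
  using frob_funpow[of 2 x] by (simp add: numeral_eq_Suc)

section \<open>The fixed field of \<open>frob\<close>\<close>

definition Fq :: "'b set" where
  "Fq = {x. frob x = x}"

lemma Fq_0 [simp]: "0 \<in> Fq"
  and Fq_1 [simp]: "1 \<in> Fq"
  and Fq_add: "x \<in> Fq \<Longrightarrow> y \<in> Fq \<Longrightarrow> x + y \<in> Fq"
  and Fq_diff: "x \<in> Fq \<Longrightarrow> y \<in> Fq \<Longrightarrow> x - y \<in> Fq"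
  and Fq_minus: "x \<in> Fq \<Longrightarrow> - x \<in> Fq"
  and Fq_mult: "x \<in> Fq \<Longrightarrow> y \<in> Fq \<Longrightarrow> x * y \<in> Fq"
  and Fq_divide: "x \<in> Fq \<Longrightarrow> y \<in> Fq \<Longrightarrow> x / y \<in> Fq"
  and Fq_inverse: "x \<in> Fq \<Longrightarrow> inverse x \<in> Fq"
  by (auto simp: Fq_def)

lemma frob_Fq: "x \<in> Fq \<Longrightarrow> frob x = x"
  by (simp add: Fq_def)

lemmas Fq_intros = Fq_0 Fq_1 Fq_add Fq_diff Fq_minus Fq_mult Fq_divide Fq_inverse

lemma card_Fq: "card Fq = q"
proof (rule antisym)
  have "Fq - {0} \<subseteq> {x. x ^ (q - 1) = 1}"
  proof
    fix x assume "x \<in> Fq - {0}"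
    hence "x * x ^ (q - 1) = x * 1" "x \<noteq> 0"
      using q_gt2 by (auto simp: Fq_def frob_def simp flip: power_Suc)
    thus "x \<in> {x. x ^ (q - 1) = 1}"
      using mult_left_cancel by blast
  qed
  hence "card (Fq - {0}) \<le> card {x::'b. x ^ (q - 1) = 1}"
    by (intro card_mono) auto
  also have "\<dots> \<le> q - 1"
    using q_gt2 by (intro card_roots_of_unity_le) simp
  finally have "card Fq - 1 \<le> q - 1"
    by simp
  thus "card Fq \<le> q"
    using q_gt2 by simp
next
  \<comment> \<open>The \<open>q ^ 4 - 1\<close> units are the roots of \<open>(X ^ (q - 1) - 1) * G\<close>, and \<open>G\<close> has too small
    a degree to account for more than \<open>q ^ 4 - q\<close> of them.\<close>
  define M where "M = q ^ 3 + q ^ 2 + q + 1"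
  define G where "G = (\<Sum>i<M. monom (1::'b) ((q - 1) * i))"
  have MQ: "(q - 1) * (M - 1) + q = q ^ 4" "(q - 1) * M + 1 = q ^ 4"
    using q_gt2 by (auto simp: M_def algebra_simps power_numeral_reduce diff_mult_distrib)
  have pG: "poly G x = (\<Sum>i<M. (x ^ (q - 1)) ^ i)" for x
    by (simp add: G_def poly_sum poly_monom power_mult)
  have "poly G 0 = 1"
    using q_gt2 by (simp add: pG M_def power_0_left sum.delta if_distrib cong: if_cong)
  hence nz: "G \<noteq> 0"
    by auto
  have "x \<in> Fq \<union> {x. poly G x = 0}" for x
  proof (cases "x = 0")
    case False
    have "x * (x ^ (q - 1)) ^ M = x"
      using finite_field_power_card[of x]
      by (simp add: card_field flip: power_mult MQ(2))
    hence "(x ^ (q - 1)) ^ M - 1 = 0"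
      using False by simp
    moreover have "(x ^ (q - 1) - 1) * poly G x = (x ^ (q - 1)) ^ M - 1"
      by (simp add: pG power_diff_1_eq)
    ultimately consider "x ^ (q - 1) = 1" | "poly G x = 0"
      by fastforce
    thus ?thesis
    proof cases
      case 1
      hence "x * x ^ (q - 1) = x" by simp
      thus ?thesis using q_gt2 by (simp add: Fq_def frob_def flip: power_Suc)
    qed simp
  qed simp
  hence "UNIV = Fq \<union> {x. poly G x = 0}"
    by blast
  hence "q ^ 4 \<le> card Fq + card {x. poly G x = 0}"
    by (metis card_Un_le card_field)
  also have "card {x. poly G x = 0} \<le> degree G"
    using nz by (rule card_poly_roots_bound)
  also have "degree G \<le> (q - 1) * (M - 1)"
    unfolding G_def by (intro degree_sum_le) (auto intro!: order.trans[OF degree_monom_le] simp: M_def)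
  finally show "q \<le> card Fq"
    using MQ(1) by simp
qed

text \<open>With N(x) = x * x^(q^2), the norm to GF(q^2), this is N(x) - N(x)^q: a quadratic form in
  four variables over \<open>Fq\<close> that vanishes exactly when N(x) lies in
  \<open>Fq\<close>.\<close>

definition Qf :: "'b \<Rightarrow> 'b" where
  "Qf x = x * frob (frob x) - frob x * frob (frob (frob x))"

definition Bf :: "'b \<Rightarrow> 'b \<Rightarrow> 'b" where
  "Bf x y = (x * frob (frob y) + y * frob (frob x))
    - (frob x * frob (frob (frob y)) + frob y * frob (frob (frob x)))"

lemma Qf_add: "Qf (x + y) = Qf x + Qf y + Bf x y"
  by (simp add: Qf_def Bf_def algebra_simps)

lemma Qf_scale: "t \<in> Fq \<Longrightarrow> Qf (t * x) = t ^ 2 * Qf x"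
  by (simp add: Qf_def frob_Fq algebra_simps power2_eq_square)

lemma Bf_add_right: "Bf x (y + z) = Bf x y + Bf x z"
  and Bf_diff_right: "Bf x (y - z) = Bf x y - Bf x z"
  by (simp_all add: Bf_def algebra_simps)

lemma Bf_scale_right: "t \<in> Fq \<Longrightarrow> Bf x (t * y) = t * Bf x y"
  and Bf_scale_left: "t \<in> Fq \<Longrightarrow> Bf (t * x) y = t * Bf x y"
  by (simp_all add: Bf_def frob_Fq algebra_simps)

lemma Bf_commute: "Bf x y = Bf y x"
  by (simp add: Bf_def algebra_simps)

lemma Bf_self: "Bf x x = 2 * Qf x"
  by (simp add: Bf_def Qf_def)

text \<open>\<open>frob\<close> swaps the two terms of the difference. So values of the forms may
  lie outside \<open>Fq\<close>, but quotients of two values lie in it and can serve as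
  coefficients.\<close>

lemma frob_Qf: "frob (Qf x) = - Qf x"
  and frob_Bf: "frob (Bf x y) = - Bf x y"
  by (simp_all add: Qf_def Bf_def algebra_simps)

text \<open>If \<open>z = x / y\<close> has trace and norm over \<open>F\<^bsub>q\<^sup>2\<^esub>\<close> in \<open>F\<^bsub>q\<^esub>\<close>, then its Frobenius
  image is a root of the same quadratic, i.e. one of \<open>z\<close> and the conjugate of \<open>z\<close>.\<close>

lemma Bf_eq_0_imp_proportional:
  assumes "Qf x = 0" "Qf y = 0" "Bf x y = 0" "y \<noteq> 0"
  obtains t where "t \<in> Fq" "x = t * y"
proof -
  define z where "z = x / y"
  \<comment> \<open>\<open>N\<close> lies in \<open>Fq\<close> because \<open>Qf y = 0\<close>, so
    it factors out of \<open>Qf x\<close> and \<open>Bf x y\<close>.\<close>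
  define N where "N = y * frob (frob y)"
  have x: "x = z * y" using assms by (simp add: z_def)
  have N: "frob N = N" "N \<noteq> 0"
    using assms(2,4) by (simp_all add: Qf_def N_def mult.commute)
  have "Qf x = N * (z * frob (frob z)) - frob N * frob (z * frob (frob z))"
    by (simp add: Qf_def N_def x algebra_simps)
  hence 1: "frob (z * frob (frob z)) = z * frob (frob z)"
    using assms N by (simp add: mult.commute)
  have "Bf x y = N * (z + frob (frob z)) - frob N * frob (z + frob (frob z))"
    by (simp add: Bf_def N_def x algebra_simps)
  hence 2: "frob (z + frob (frob z)) = z + frob (frob z)"
    using assms N by (simp add: add.commute)
  have "(frob z - z) * (frob z - frob (frob z))
      = frob z ^ 2 - (z + frob (frob z)) * frob z + z * frob (frob z)"
    by (simp add: algebra_simps power2_eq_square)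
  also have "\<dots> = frob z ^ 2 - frob (z + frob (frob z)) * frob z + frob (z * frob (frob z))"
    by (simp only: 1 2)
  also have "\<dots> = 0"
    by (simp add: algebra_simps power2_eq_square)
  finally have "frob z = z"
    by auto
  thus ?thesis
    using that[of z] x by (simp add: Fq_def)
qed

end

section \<open>Plane sections of the elliptic quadric\<close>

text \<open>The \<open>\<beta> i\<close> represent q^2 + 1 distinct singular points of PG(3, q);
  that they exhaust the quadric follows by counting.\<close>

locale elliptic_quadric = quartic_frobenius ty q
  for ty :: "'b::{field,finite} itself" and q :: nat +
  fixes \<beta> :: "nat \<Rightarrow> 'b" and n :: nat
  assumes n_def: "n = q ^ 2 + 1"
    and point_nonzero: "\<And>i. i < n \<Longrightarrow> \<beta> i \<noteq> 0"
    and on_quadric: "\<And>i. i < n \<Longrightarrow> Qf (\<beta> i) = 0"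
    and not_proportional: "\<And>i j t. i < n \<Longrightarrow> j < n \<Longrightarrow> t \<in> Fq \<Longrightarrow> \<beta> i = t * \<beta> j \<Longrightarrow> i = j"
begin

text \<open>Orthogonal singular vectors are proportional, so the quadric contains no line.\<close>

lemma Bf_points_nonzero: "i < n \<Longrightarrow> j < n \<Longrightarrow> i \<noteq> j \<Longrightarrow> Bf (\<beta> i) (\<beta> j) \<noteq> 0"
  using Bf_eq_0_imp_proportional[of "\<beta> i" "\<beta> j"] on_quadric point_nonzero not_proportional
  by metis

lemma Bf_scaled_points:
  assumes "s \<in> Fq" "t \<in> Fq"
  shows "Bf (s * \<beta> i) (t * \<beta> j) = s * t * Bf (\<beta> i) (\<beta> j)"
  using assms by (simp add: Bf_scale_left Bf_scale_right)

text \<open>If \<open>x \<beta>\<^sub>i + y \<beta>\<^sub>j\<close> is a multiple of a point, its \<open>Qf\<close> value \<open>x y B(\<beta>\<^sub>i, \<beta>\<^sub>j)\<close> vanishes.\<close>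

lemma three_points_aux:
  assumes "i < n" "j < n" "k < n" "i \<noteq> j"
    and "x \<in> Fq" "y \<in> Fq" "z \<in> Fq" and "x * \<beta> i + y * \<beta> j + z * \<beta> k = 0"
  shows "x = 0 \<or> y = 0"
proof -
  have "x * \<beta> i + y * \<beta> j = - z * \<beta> k"
    using assms(8) by (simp add: eq_neg_iff_add_eq_0)
  hence "Qf (x * \<beta> i + y * \<beta> j) = Qf (- z * \<beta> k)"
    by simp
  also have "\<dots> = 0"
    using assms on_quadric by (subst Qf_scale) (auto intro: Fq_intros)
  finally have "x * y * Bf (\<beta> i) (\<beta> j) = 0"
    using assms on_quadric by (simp add: Qf_add Qf_scale Bf_scaled_points)
  thus ?thesis
    using assms Bf_points_nonzero by auto
qed

lemma three_points_independent:
  assumes "i < n" "j < n" "k < n" "i \<noteq> j" "i \<noteq> k" "j \<noteq> k"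
    and "x \<in> Fq" "y \<in> Fq" "z \<in> Fq" and eq: "x * \<beta> i + y * \<beta> j + z * \<beta> k = 0"
  shows "x = 0 \<and> y = 0 \<and> z = 0"
proof -
  have "x = 0 \<or> y = 0"
    using three_points_aux[of i j k x y z] assms by auto
  moreover have "x = 0 \<or> z = 0"
    using three_points_aux[of i k j x z y] assms by (auto simp: add_ac)
  moreover have "y = 0 \<or> z = 0"
    using three_points_aux[of j k i y z x] assms by (auto simp: add_ac)
  ultimately show ?thesis
    using eq point_nonzero assms by auto
qed

text \<open>\<open>x ^ n\<close> is the norm to GF(q^2), and a nonzero element lies in
  \<open>Fq\<close> when its \<open>(q - 1)\<close>-th power is 1. Singular vectors become roots of
  unity, which can be counted.\<close>

lemma norm_eq_iff_Qf_eq_0: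
  assumes "x \<noteq> 0"
  shows "Qf x = 0 \<longleftrightarrow> x ^ (n * (q - 1)) = 1"
proof -
  have N: "x ^ n = x * frob (frob x)"
    by (simp add: n_def frob2_power)
  have "Qf x = 0 \<longleftrightarrow> frob (x ^ n) = x ^ n"
    unfolding N by (auto simp: Qf_def)
  also have "frob (x ^ n) = x ^ n * (x ^ n) ^ (q - 1)"
    using q_gt2 by (simp add: frob_def flip: power_Suc)
  also have "\<dots> = x ^ n \<longleftrightarrow> (x ^ n) ^ (q - 1) = 1"
    using assms by simp
  finally show ?thesis
    by (simp add: power_mult)
qed

lemma inj_on_scaled_points: "inj_on (\<lambda>(j, t). t * \<beta> j) ({..<n} \<times> (Fq - {0}))"
proof -
  have "i = j \<and> s = t"
    if *: "i < n" "s \<in> Fq" "s \<noteq> 0" "j < n" "t \<in> Fq" "t \<noteq> 0" "s * \<beta> i = t * \<beta> j" for i j s t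
  proof -
    have "\<beta> i = t / s * \<beta> j"
      using * by (simp add: field_simps)
    hence "i = j"
      using * not_proportional Fq_divide by blast
    thus ?thesis
      using * point_nonzero[of j] by auto
  qed
  thus ?thesis
    by (auto simp: inj_on_def)
qed

text \<open>The points have \<open>n * (q - 1)\<close> nonzero multiples over \<open>Fq\<close>, and
  at most that many solutions of \<open>x ^ (n * (q - 1)) = 1\<close> exist, so no singular vector
  is missed.\<close>

lemma quadric_vectors:
  "(\<lambda>(j, t). t * \<beta> j) ` ({..<n} \<times> (Fq - {0})) = {x. x \<noteq> 0 \<and> Qf x = 0}" (is "?f ` ?A = ?B")
proof (rule card_subset_eq)
  show sub: "?f ` ?A \<subseteq> ?B"
    using point_nonzero on_quadric by (auto simp: Qf_scale)
  have "?B \<subseteq> {x. x ^ (n * (q - 1)) = 1}"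
    using norm_eq_iff_Qf_eq_0 by blast
  hence "card ?B \<le> card {x::'b. x ^ (n * (q - 1)) = 1}"
    by (intro card_mono) auto
  also have "\<dots> \<le> n * (q - 1)"
    using q_gt2 by (intro card_roots_of_unity_le) (simp add: n_def)
  also have "\<dots> = card (?f ` ?A)"
    by (simp add: card_image[OF inj_on_scaled_points] card_cartesian_product card_Fq)
  finally show "card (?f ` ?A) = card ?B"
    by (intro antisym card_mono[OF _ sub]) auto
qed simp

text \<open>In a plane \<open>V\<close> through the point \<open>P\<close>, every line through \<open>P\<close> outside the tangent plane
  \<open>P\<^sup>\<bottom>\<close> meets the quadric in exactly one further point.\<close>

lemma card_plane_section:
  assumes add: "\<And>x y. x \<in> V \<Longrightarrow> y \<in> V \<Longrightarrow> x + y \<in> V"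
    and scale: "\<And>t x. t \<in> Fq \<Longrightarrow> x \<in> V \<Longrightarrow> t * x \<in> V"
    and card_V: "card V = q ^ 3"
    and ij: "i < n" "j < n" "i \<noteq> j" "\<beta> i \<in> V" "\<beta> j \<in> V"
  shows "card {k. k < n \<and> \<beta> k \<in> V} = q + 1"
proof -
  let ?g = "Bf (\<beta> i)"
  let ?K = "{v\<in>V. ?g v = 0}"
  let ?W = "{v\<in>V. Qf v = 0 \<and> ?g v \<noteq> 0}"
  let ?J = "{k. k < n \<and> \<beta> k \<in> V} - {i}"
  have diff: "x - y \<in> V" if "x \<in> V" "y \<in> V" for x y
    using add[OF that(1) scale[of "-1" y]] that Fq_minus[of 1] by simp
  have gj: "?g (\<beta> j) \<noteq> 0"
    using ij Bf_points_nonzero by blast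
  have gi: "?g (\<beta> i) = 0"
    using ij on_quadric by (simp add: Bf_self)
  have ratio: "?g v / ?g w \<in> Fq" "Qf v / ?g w \<in> Fq" for v w
    by (auto simp: Fq_def frob_Bf frob_Qf)

  have gt: "?g (?g v / ?g (\<beta> j) * \<beta> j) = ?g v" for v
    using gj Bf_scale_right[OF ratio(1)] by simp
  \<comment> \<open>As \<open>\<beta> j\<close> is not orthogonal to \<open>\<beta> i\<close>,
    \<open>V\<close> is the direct sum of the tangent part \<open>?K\<close> and the line spanned by
    \<open>\<beta> j\<close>.\<close>
  have "bij_betw (\<lambda>(w, t). w + t * \<beta> j) (?K \<times> Fq) V"
    by (rule bij_betw_byWitness[where f' = "\<lambda>v. (v - ?g v / ?g (\<beta> j) * \<beta> j, ?g v / ?g (\<beta> j))"])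
      (use gj ij gt in \<open>auto simp: Bf_add_right Bf_diff_right Bf_scale_right ratio
        simp del: times_divide_eq_left intro!: add diff scale ratio\<close>)
  from bij_betw_same_card[OF this] have "card ?K * q = q ^ 3"
    by (simp add: card_cartesian_product card_Fq card_V)
  hence card_K: "card ?K = q ^ 2"
    using q_gt2 by (simp add: power_numeral_reduce)

  have shift: "?g (v + t * \<beta> i) = ?g v" "Qf (v + t * \<beta> i) = Qf v + t * ?g v" if "t \<in> Fq" for t v
    using that gi ij on_quadric
    by (simp_all add: Bf_add_right Bf_scale_right Qf_add Qf_scale Bf_commute[of v "t * \<beta> i"]
      Bf_scale_left)
  \<comment> \<open>Along \<open>v + t * \<beta> i\<close> the form \<open>Qf\<close> is affine in
    \<open>t\<close> with slope \<open>?g v\<close>; off \<open>?K\<close> it vanishes for exactly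
    one \<open>t\<close>, namely \<open>- u v\<close>.\<close>
  define u where "u = (\<lambda>v. Qf v / ?g v)"
  have u: "u v \<in> Fq" "- u v \<in> Fq" for v
    using ratio Fq_minus by (auto simp: u_def)
  have u_shift: "u (w + t * \<beta> i) = t" if "w \<in> ?W" "t \<in> Fq" for w t
    using that by (simp add: u_def shift)
  have Qf_u: "Qf (v + - u v * \<beta> i) = 0" if "v \<in> V - ?K" for v
    using that unfolding shift(2)[OF u(2)] by (simp add: u_def)
  have "bij_betw (\<lambda>(w, t). w + t * \<beta> i) (?W \<times> Fq) (V - ?K)"
  proof (rule bij_betw_byWitness[where f' = "\<lambda>v. (v + - u v * \<beta> i, u v)"])
    show "(\<lambda>(w, t). w + t * \<beta> i) ` (?W \<times> Fq) \<subseteq> V - ?K"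
      using ij by (auto simp: shift intro!: add scale)
    show "(\<lambda>v. (v + - u v * \<beta> i, u v)) ` (V - ?K) \<subseteq> ?W \<times> Fq"
      using ij u Qf_u shift(1)[OF u(2)] by (auto simp del: mult_minus_left intro!: add scale)
  qed (use u_shift in auto)
  from bij_betw_same_card[OF this] have "card ?W * q = card (V - ?K)"
    by (simp add: card_cartesian_product card_Fq)
  also have "\<dots> = q ^ 3 - q ^ 2"
    by (subst card_Diff_subset) (auto simp: card_V card_K)
  finally have card_W: "card ?W * q = q ^ 3 - q ^ 2" .

  \<comment> \<open>By \<open>quadric_vectors\<close>, \<open>?W\<close> consists of the nonzero
    multiples of the points of \<open>V\<close> other than \<open>\<beta> i\<close>.\<close>
  have "bij_betw (\<lambda>(k, t). t * \<beta> k) (?J \<times> (Fq - {0})) ?W"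
  proof (rule bij_betw_imageI)
    show "inj_on (\<lambda>(k, t). t * \<beta> k) (?J \<times> (Fq - {0}))"
      by (rule inj_on_subset[OF inj_on_scaled_points]) auto
    show "(\<lambda>(k, t). t * \<beta> k) ` (?J \<times> (Fq - {0})) = ?W"
    proof (intro equalityI subsetI)
      fix w assume "w \<in> (\<lambda>(k, t). t * \<beta> k) ` (?J \<times> (Fq - {0}))"
      thus "w \<in> ?W"
        using ij on_quadric Bf_points_nonzero by (auto simp: Qf_scale Bf_scale_right intro!: scale)
    next
      fix w assume w: "w \<in> ?W"
      hence "w \<in> {x. x \<noteq> 0 \<and> Qf x = 0}"
        using Bf_scale_right[OF Fq_0, of "\<beta> i" 0] by auto
      then obtain k t where kt: "k < n" "t \<in> Fq" "t \<noteq> 0" "w = t * \<beta> k"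
        unfolding quadric_vectors[symmetric] by auto
      moreover have "k \<noteq> i"
        using w kt gi by (auto simp: Bf_scale_right)
      moreover have "\<beta> k \<in> V"
        using scale[of "inverse t" w] w kt Fq_inverse by (auto simp: field_simps)
      ultimately show "w \<in> (\<lambda>(k, t). t * \<beta> k) ` (?J \<times> (Fq - {0}))"
        by (intro image_eqI[of _ _ "(k, t)"]) auto
    qed
  qed
  hence "card (?J \<times> (Fq - {0})) = card ?W"
    by (rule bij_betw_same_card)
  hence "card ?J * (q - 1) = card ?W"
    by (simp add: card_cartesian_product card_Fq)
  hence "card ?J * ((q - 1) * q) = q ^ 3 - q ^ 2"
    using card_W by (simp only: mult.assoc[symmetric])
  also have "\<dots> = q * ((q - 1) * q)"
    by (simp add: algebra_simps power_numeral_reduce diff_mult_distrib2)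
  finally have "card ?J = q"
    using q_gt2 by simp
  thus ?thesis
    using ij q_gt2 by simp
qed

end

section \<open>The code of the quadric\<close>

context elliptic_quadric
begin

definition plane :: "nat \<Rightarrow> nat \<Rightarrow> nat \<Rightarrow> 'b set" where
  "plane i j k = (\<lambda>(x, y, z). x * \<beta> i + y * \<beta> j + z * \<beta> k) ` (Fq \<times> Fq \<times> Fq)"

definition independent4 :: "nat \<Rightarrow> nat \<Rightarrow> nat \<Rightarrow> nat \<Rightarrow> bool" where
  "independent4 i j k l \<longleftrightarrow> (\<forall>x\<in>Fq. \<forall>y\<in>Fq. \<forall>z\<in>Fq. \<forall>w\<in>Fq.
     x * \<beta> i + y * \<beta> j + z * \<beta> k + w * \<beta> l = 0 \<longrightarrow> x = 0 \<and> y = 0 \<and> z = 0 \<and> w = 0)"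

lemma planeI: "x \<in> Fq \<Longrightarrow> y \<in> Fq \<Longrightarrow> z \<in> Fq \<Longrightarrow> x * \<beta> i + y * \<beta> j + z * \<beta> k \<in> plane i j k"
  unfolding plane_def by (rule image_eqI[of _ _ "(x, y, z)"]) auto

lemma planeE:
  assumes "v \<in> plane i j k"
  obtains x y z where "x \<in> Fq" "y \<in> Fq" "z \<in> Fq" "v = x * \<beta> i + y * \<beta> j + z * \<beta> k"
  using assms by (auto simp: plane_def)

lemma plane_add:
  assumes "v \<in> plane i j k" "w \<in> plane i j k"
  shows "v + w \<in> plane i j k"
proof -
  from assms obtain x y z x' y' z' where
    *: "x \<in> Fq" "y \<in> Fq" "z \<in> Fq" "v = x * \<beta> i + y * \<beta> j + z * \<beta> k"
       "x' \<in> Fq" "y' \<in> Fq" "z' \<in> Fq" "w = x' * \<beta> i + y' * \<beta> j + z' * \<beta> k"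
    by (elim planeE)
  have "v + w = (x + x') * \<beta> i + (y + y') * \<beta> j + (z + z') * \<beta> k"
    by (simp add: * algebra_simps)
  thus ?thesis
    using * by (auto intro!: planeI Fq_add)
qed

lemma plane_scale:
  assumes "t \<in> Fq" "v \<in> plane i j k"
  shows "t * v \<in> plane i j k"
proof -
  from assms obtain x y z where
    *: "x \<in> Fq" "y \<in> Fq" "z \<in> Fq" "v = x * \<beta> i + y * \<beta> j + z * \<beta> k"
    by (elim planeE)
  have "t * v = (t * x) * \<beta> i + (t * y) * \<beta> j + (t * z) * \<beta> k"
    by (simp add: * algebra_simps)
  thus ?thesis
    using * assms by (auto intro!: planeI Fq_mult)
qed

lemma plane_0: "0 \<in> plane i j k"
  using planeI[of 0 0 0] by simp

lemma plane_sum: "(\<And>a. a \<in> A \<Longrightarrow> f a \<in> plane i j k) \<Longrightarrow> sum f A \<in> plane i j k"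
  by (induction A rule: infinite_finite_induct) (auto intro: plane_0 plane_add)

lemma points_in_plane: "\<beta> i \<in> plane i j k" "\<beta> j \<in> plane i j k" "\<beta> k \<in> plane i j k"
  using planeI[of 1 0 0 i j k] planeI[of 0 1 0 i j k] planeI[of 0 0 1 i j k] by auto

lemma card_plane:
  assumes "i < n" "j < n" "k < n" "i \<noteq> j" "i \<noteq> k" "j \<noteq> k"
  shows "card (plane i j k) = q ^ 3"
proof -
  have uniq: "x = x' \<and> y = y' \<and> z = z'"
    if *: "x \<in> Fq" "y \<in> Fq" "z \<in> Fq" "x' \<in> Fq" "y' \<in> Fq" "z' \<in> Fq"
      "x * \<beta> i + y * \<beta> j + z * \<beta> k = x' * \<beta> i + y' * \<beta> j + z' * \<beta> k" for x y z x' y' z'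
  proof -
    have "(x - x') * \<beta> i + (y - y') * \<beta> j + (z - z') * \<beta> k = 0"
      using *(7) by (simp add: algebra_simps)
    from three_points_independent[OF assms _ _ _ this] * show ?thesis
      by (simp add: Fq_diff)
  qed
  have "inj_on (\<lambda>(x, y, z). x * \<beta> i + y * \<beta> j + z * \<beta> k) (Fq \<times> Fq \<times> Fq)"
    by (rule inj_onI, clarify, unfold prod.case prod.inject, rule uniq; assumption)
  thus ?thesis
    unfolding plane_def
    by (simp add: card_image card_cartesian_product card_Fq power_numeral_reduce)
qed

lemma card_points_in_plane:
  assumes "i < n" "j < n" "k < n" "i \<noteq> j" "i \<noteq> k" "j \<noteq> k"
  shows "card {m. m < n \<and> \<beta> m \<in> plane i j k} = q + 1"
  using assms points_in_plane
  by (intro card_plane_section[of _ i j] plane_add plane_scale card_plane)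

text \<open>A plane holds only \<open>q + 1\<close> points, so one of any \<open>q + 2\<close> lies
  off it and completes the three given points to a basis.\<close>

lemma independent4_extend:
  assumes "i < n" "j < n" "k < n" "i \<noteq> j" "i \<noteq> k" "j \<noteq> k"
    and "T \<subseteq> {..<n}" "q + 2 \<le> card T"
  obtains l where "l \<in> T" "\<beta> l \<notin> plane i j k" "independent4 i j k l"
proof -
  have "\<not> T \<subseteq> {m. m < n \<and> \<beta> m \<in> plane i j k}"
    using card_points_in_plane[OF assms(1-6)] assms(8)
      card_mono[of "{m. m < n \<and> \<beta> m \<in> plane i j k}" T] by auto
  then obtain l where l: "l \<in> T" "\<beta> l \<notin> plane i j k"
    using assms(7) by auto
  have "independent4 i j k l"
    unfolding independent4_def
  proof (intro ballI impI)
    fix x y z w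
    assume *: "x \<in> Fq" "y \<in> Fq" "z \<in> Fq" "w \<in> Fq"
      "x * \<beta> i + y * \<beta> j + z * \<beta> k + w * \<beta> l = 0"
    have w: "w = 0"
    proof (rule ccontr)
      assume "w \<noteq> 0"
      have "\<beta> l = - 1 / w * (x * \<beta> i + y * \<beta> j + z * \<beta> k)"
        using *(5) \<open>w \<noteq> 0\<close> by (simp add: field_simps add_eq_0_iff)
      also have "\<dots> \<in> plane i j k"
        using * by (intro plane_scale planeI Fq_intros)
      finally show False
        using l by simp
    qed
    thus "x = 0 \<and> y = 0 \<and> z = 0 \<and> w = 0"
      using * three_points_independent[OF assms(1-6), of x y z] by simp
  qed
  thus ?thesis
    using that l by blast
qed

lemma independent4_spans:
  assumes "independent4 i j k l"
  obtains x y z w where "x \<in> Fq" "y \<in> Fq" "z \<in> Fq" "w \<in> Fq"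
    "v = x * \<beta> i + y * \<beta> j + z * \<beta> k + w * \<beta> l"
proof -
  let ?f = "\<lambda>(x, y, z, w). x * \<beta> i + y * \<beta> j + z * \<beta> k + w * \<beta> l"
  let ?A = "Fq \<times> Fq \<times> Fq \<times> Fq"
  have uniq: "x = x' \<and> y = y' \<and> z = z' \<and> w = w'"
    if *: "x \<in> Fq" "y \<in> Fq" "z \<in> Fq" "w \<in> Fq" "x' \<in> Fq" "y' \<in> Fq" "z' \<in> Fq" "w' \<in> Fq"
      "x * \<beta> i + y * \<beta> j + z * \<beta> k + w * \<beta> l = x' * \<beta> i + y' * \<beta> j + z' * \<beta> k + w' * \<beta> l"
    for x y z w x' y' z' w'
  proof -
    have "(x - x') * \<beta> i + (y - y') * \<beta> j + (z - z') * \<beta> k + (w - w') * \<beta> l = 0"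
      using *(9) by (simp add: algebra_simps)
    moreover have "x - x' \<in> Fq" "y - y' \<in> Fq" "z - z' \<in> Fq" "w - w' \<in> Fq"
      using * by (auto intro: Fq_diff)
    ultimately have "x - x' = 0 \<and> y - y' = 0 \<and> z - z' = 0 \<and> w - w' = 0"
      using assms unfolding independent4_def by blast
    thus ?thesis
      by simp
  qed
  have "inj_on ?f ?A"
    by (rule inj_onI, clarify, unfold prod.case prod.inject, rule uniq; assumption)
  hence "card (?f ` ?A) = CARD('b)"
    by (simp add: card_image card_cartesian_product card_Fq card_field power_numeral_reduce)
  hence "?f ` ?A = UNIV"
    by (intro card_subset_eq) auto
  hence "v \<in> ?f ` ?A"
    by simp
  thus ?thesis
    using that by auto
qed

lemma independent4_distinct:
  assumes "independent4 i j k l"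
  shows "distinct [i, j, k, l]"
proof -
  have I: "x * \<beta> i + y * \<beta> j + z * \<beta> k + w * \<beta> l = 0 \<Longrightarrow> x \<in> Fq \<Longrightarrow> y \<in> Fq \<Longrightarrow> z \<in> Fq \<Longrightarrow> w \<in> Fq
      \<Longrightarrow> x = 0 \<and> y = 0 \<and> z = 0 \<and> w = 0" for x y z w
    using assms unfolding independent4_def by blast
  have m: "-1 \<in> Fq"
    by (intro Fq_intros)
  show ?thesis
    using I[of 1 "-1" 0 0] I[of 1 0 "-1" 0] I[of 1 0 0 "-1"] I[of 0 1 "-1" 0] I[of 0 1 0 "-1"]
      I[of 0 0 1 "-1"] m by auto
qed

text \<open>The linear code over \<open>Fq\<close> whose parity check columns are the
  \<open>\<beta> i\<close>. Entries keep the type \<open>'b\<close>, since \<open>Fq\<close> is a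
  set and not a type.\<close>

definition quadric_code :: "(nat \<Rightarrow> 'b) set" where
  "quadric_code = {y \<in> words n Fq. (\<Sum>i<n. y i * \<beta> i) = 0}"

lemma n_ge: "q + 7 \<le> n"
proof -
  have "3 * q \<le> q * q" "3 \<le> q"
    using q_gt2 by auto
  thus ?thesis
    unfolding n_def power2_eq_square by linarith
qed

lemma sum_support:
  assumes "J \<subseteq> {..<n}" "\<And>j. j < n \<Longrightarrow> j \<notin> J \<Longrightarrow> y j = 0"
  shows "(\<Sum>i<n. y i * \<beta> i) = (\<Sum>i\<in>J. y i * \<beta> i)"
  using assms by (intro sum.mono_neutral_right) auto

text \<open>Such a word is a dependency among three points; the support is padded to exactly three
  positions so that independence applies.\<close>

lemma quadric_code_weight:
  assumes y: "y \<in> quadric_code" and "hweight n y \<le> 3"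
  shows "y = 0"
proof -
  obtain J where J: "{i. i < n \<and> y i \<noteq> 0} \<subseteq> J" "J \<subseteq> {..<n}" "card J = 3"
    using exists_subset_between[of "{i. i < n \<and> y i \<noteq> 0}" 3 "{..<n}"] assms(2) n_ge
    by (auto simp: hweight_def)
  then obtain i j k where ijk: "J = {i, j, k}" "i \<noteq> j" "i \<noteq> k" "j \<noteq> k"
    by (auto simp: card_3_iff)
  have "(\<Sum>i<n. y i * \<beta> i) = (\<Sum>i\<in>J. y i * \<beta> i)"
    using J by (intro sum_support) auto
  hence "y i * \<beta> i + y j * \<beta> j + y k * \<beta> k = 0"
    using y ijk by (simp add: quadric_code_def add_ac)
  hence "y i = 0 \<and> y j = 0 \<and> y k = 0"
    using three_points_independent[of i j k "y i" "y j" "y k"] y ijk J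
    by (auto simp: quadric_code_def words_def)
  moreover have "y m = 0" if "m \<notin> J" for m
    using that J y by (cases "m < n") (auto simp: quadric_code_def words_def)
  ultimately show ?thesis
    unfolding ijk(1) by (metis insert_iff singletonD zero_fun_def ext)
qed

text \<open>\<open>T\<close> is too large to be coplanar, so it contains a basis, and expanding
  \<open>\<beta> m\<close> in it gives the word. Thus entry \<open>m\<close> is not determined by
  the positions outside \<open>insert m T\<close>.\<close>

lemma quadric_code_recovery:
  assumes "T \<subseteq> {..<n}" "q + 2 \<le> card T" "m < n" "m \<notin> T"
  obtains y where "y \<in> quadric_code" "y m \<noteq> 0" "\<And>j. j \<notin> insert m T \<Longrightarrow> y j = 0"
proof -
  have "3 \<le> card T"
    using assms q_gt2 by simp
  then obtain J where "J \<subseteq> T" "card J = 3"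
    by (metis obtain_subset_with_card_n)
  then obtain i j k where ijk: "i \<in> T" "j \<in> T" "k \<in> T" "i \<noteq> j" "i \<noteq> k" "j \<noteq> k"
    by (auto simp: card_3_iff)
  hence "i < n" "j < n" "k < n"
    using assms by auto
  then obtain l where l: "l \<in> T" "independent4 i j k l"
    using independent4_extend[of i j k T] ijk assms by metis
  obtain x y z w where xyzw: "x \<in> Fq" "y \<in> Fq" "z \<in> Fq" "w \<in> Fq"
    "\<beta> m = x * \<beta> i + y * \<beta> j + z * \<beta> k + w * \<beta> l"
    using independent4_spans[OF l(2)] by metis
  have dist: "distinct [m, i, j, k, l]"
    using independent4_distinct[OF l(2)] ijk l assms by auto
  define c where "c = (\<lambda>_. 0)(m := -1, i := x, j := y, k := z, l := w)"
  have supp: "c a = 0" if "a \<notin> {m, i, j, k, l}" for a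
    using that by (simp add: c_def)
  have sub: "{m, i, j, k, l} \<subseteq> insert m T" "{m, i, j, k, l} \<subseteq> {..<n}"
    using assms ijk l by auto
  have "(\<Sum>a<n. c a * \<beta> a) = (\<Sum>a\<in>{m, i, j, k, l}. c a * \<beta> a)"
    using sub supp by (intro sum_support) blast+
  also have "\<dots> = 0"
    using dist by (simp add: c_def xyzw(5))
  finally have "(\<Sum>a<n. c a * \<beta> a) = 0" .
  moreover have "c a \<in> Fq" for a
    using xyzw Fq_minus[OF Fq_1] by (simp add: c_def)
  moreover have "c a = 0" if "n \<le> a" for a
    by (rule supp) (use sub(2) that in \<open>auto simp del: insert_iff\<close>)
  ultimately have "c \<in> quadric_code"
    by (simp add: quadric_code_def words_def)
  moreover have "c m \<noteq> 0"
    using dist by (simp add: c_def)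
  moreover have "c a = 0" if "a \<notin> insert m T" for a
    by (rule supp) (use sub(1) that in blast)
  ultimately show ?thesis
    using that by blast
qed

text \<open>\<open>J\<close> consists of four independent points, so the other positions determine a
  word; this bounds the dimension from above.\<close>

lemma quadric_code_information_set:
  obtains J where "J \<subseteq> {..<n}" "card J = 4"
    "\<And>y. y \<in> quadric_code \<Longrightarrow> (\<And>j. j \<notin> J \<Longrightarrow> y j = 0) \<Longrightarrow> y = 0"
proof -
  have "0 < n" "1 < n" "2 < n"
    using n_ge by auto
  then obtain l where l: "l < n" "independent4 0 1 2 l"
    using independent4_extend[of 0 1 2 "{..<n}"] n_ge by auto
  note dist = independent4_distinct[OF l(2)]
  have "y = 0" if y: "y \<in> quadric_code" "\<And>j. j \<notin> {0, 1, 2, l} \<Longrightarrow> y j = 0" for y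
  proof -
    have "(\<Sum>i<n. y i * \<beta> i) = (\<Sum>i\<in>{0, 1, 2, l}. y i * \<beta> i)"
      using y(2) l n_ge by (intro sum_support) auto
    hence "y 0 * \<beta> 0 + y 1 * \<beta> 1 + y 2 * \<beta> 2 + y l * \<beta> l = 0"
      using y(1) dist by (simp add: quadric_code_def add_ac)
    moreover have "y 0 \<in> Fq" "y 1 \<in> Fq" "y 2 \<in> Fq" "y l \<in> Fq"
      using y(1) l n_ge by (auto simp: quadric_code_def words_def)
    ultimately have "y 0 = 0 \<and> y 1 = 0 \<and> y 2 = 0 \<and> y l = 0"
      using l(2) unfolding independent4_def by blast
    hence "y a = 0" for a
      using y(2)[of a] by (cases "a \<in> {0, 1, 2, l}") (elim insertE, simp_all)
    thus ?thesis
      by (simp add: fun_eq_iff)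
  qed
  moreover have "{0, 1, 2, l} \<subseteq> {..<n}" "card {0, 1, 2, l} = 4"
    using l n_ge dist by auto
  ultimately show ?thesis
    using that by blast
qed

text \<open>\<open>J\<close> is the section by a plane missing \<open>\<beta> i\<close>. A word on
  \<open>insert i J\<close> with nonzero entry at \<open>i\<close> would put
  \<open>\<beta> i\<close> into that plane.\<close>

lemma quadric_code_local_recovery:
  assumes "i < n"
  obtains J where "J \<subseteq> {..<n}" "card J = q + 1" "i \<notin> J"
    "\<And>y. y \<in> quadric_code \<Longrightarrow> (\<And>j. j \<notin> insert i J \<Longrightarrow> y j = 0) \<Longrightarrow> y i = 0"
proof -
  have "2 \<le> card ({..<n} - {i})"
    using assms n_ge by simp
  then obtain S where "S \<subseteq> {..<n} - {i}" "card S = 2"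
    by (metis obtain_subset_with_card_n)
  then obtain j k where jk: "j < n" "k < n" "i \<noteq> j" "i \<noteq> k" "j \<noteq> k"
    by (auto simp: card_2_iff)
  then obtain l where l: "l < n" "independent4 i j k l"
    using independent4_extend[of i j k "{..<n}"] assms n_ge by auto
  note dist = independent4_distinct[OF l(2)]
  let ?J = "{m. m < n \<and> \<beta> m \<in> plane j k l}"
  have nin: "\<beta> i \<notin> plane j k l"
  proof
    assume "\<beta> i \<in> plane j k l"
    then obtain x y z where xyz: "x \<in> Fq" "y \<in> Fq" "z \<in> Fq" "\<beta> i = x * \<beta> j + y * \<beta> k + z * \<beta> l"
      by (elim planeE)
    hence "(- 1) * \<beta> i + x * \<beta> j + y * \<beta> k + z * \<beta> l = 0"
      by simp
    moreover have "- 1 \<in> Fq"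
      by (intro Fq_intros)
    ultimately have "(- 1 :: 'b) = 0"
      using l(2) xyz unfolding independent4_def by blast
    thus False
      by simp
  qed
  have "y i = 0" if y: "y \<in> quadric_code" "\<And>j. j \<notin> insert i ?J \<Longrightarrow> y j = 0" for y
  proof (rule ccontr)
    assume nz: "y i \<noteq> 0"
    have Fq: "y m \<in> Fq" if "m < n" for m
      using y(1) that by (auto simp: quadric_code_def words_def)
    have "(\<Sum>m<n. y m * \<beta> m) = (\<Sum>m\<in>insert i ?J. y m * \<beta> m)"
      using y(2) assms by (intro sum_support) auto
    also have "\<dots> = y i * \<beta> i + (\<Sum>m\<in>?J. y m * \<beta> m)"
      using nin by simp
    finally have "y i * \<beta> i = - 1 * (\<Sum>m\<in>?J. y m * \<beta> m)"
      using y(1) by (simp add: quadric_code_def eq_neg_iff_add_eq_0)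
    hence "\<beta> i = - 1 / y i * (\<Sum>m\<in>?J. y m * \<beta> m)"
      using nz by (simp add: field_simps)
    also have "\<dots> \<in> plane j k l"
      using Fq assms by (intro plane_scale plane_sum Fq_divide Fq_minus Fq_1) auto
    finally show False
      using nin by simp
  qed
  moreover have "card ?J = q + 1"
    by (rule card_points_in_plane) (use jk l dist in auto)
  moreover have "?J \<subseteq> {..<n}" "i \<notin> ?J"
    using nin by auto
  ultimately show ?thesis
    using that by blast
qed

text \<open>As \<open>q > 2\<close>, the plane through three points contains a fourth, which is a
  combination of them.\<close>

lemma quadric_code_weight4:
  obtains y where "y \<in> quadric_code" "y \<noteq> 0" "hweight n y \<le> 4"
proof -
  have lt: "0 < n" "1 < n" "2 < n"
    using n_ge by auto
  let ?J = "{m. m < n \<and> \<beta> m \<in> plane 0 1 2}"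
  have "{0, 1, 2} \<subseteq> ?J"
    using lt by (simp add: points_in_plane del: One_nat_def)
  hence "card (?J - {0, 1, 2}) = q + 1 - 3"
    using card_points_in_plane[OF lt] by (simp add: card_Diff_subset)
  hence "card (?J - {0, 1, 2}) \<noteq> 0"
    using q_gt2 by linarith
  hence "?J - {0, 1, 2} \<noteq> {}"
    unfolding card_eq_0_iff by blast
  then obtain l where l: "l < n" "\<beta> l \<in> plane 0 1 2" "l \<notin> {0, 1, 2}"
    by blast
  then obtain x y z where xyz: "x \<in> Fq" "y \<in> Fq" "z \<in> Fq" "\<beta> l = x * \<beta> 0 + y * \<beta> 1 + z * \<beta> 2"
    by (elim planeE)
  define c where "c = (\<lambda>_. 0)(l := -1, 0 := x, 1 := y, 2 := z)"
  have supp: "c a = 0" if "a \<notin> {l, 0, 1, 2}" for a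
    using that by (simp add: c_def)
  have sub: "{l, 0, 1, 2} \<subseteq> {..<n}"
    using l lt by auto
  have "(\<Sum>a<n. c a * \<beta> a) = (\<Sum>a\<in>{l, 0, 1, 2}. c a * \<beta> a)"
    using sub supp by (intro sum_support) blast+
  also have "\<dots> = 0"
    using l by (simp add: c_def xyz(4))
  finally have "(\<Sum>a<n. c a * \<beta> a) = 0" .
  moreover have "c a \<in> Fq" for a
    using xyz Fq_minus[OF Fq_1] by (simp add: c_def)
  moreover have "c a = 0" if "n \<le> a" for a
    by (rule supp) (use sub that in \<open>auto simp del: insert_iff\<close>)
  ultimately have "c \<in> quadric_code"
    by (simp add: quadric_code_def words_def)
  moreover have "c \<noteq> 0"
  proof
    assume "c = 0"
    hence "c l = 0" by simp
    thus False using l by (simp add: c_def)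
  qed
  moreover have "hweight n c \<le> 4"
  proof -
    have "hweight n c \<le> card {l, 0, 1, 2}"
      unfolding hweight_def using supp by (intro card_mono) blast+
    also have "\<dots> = 4"
      using l by simp
    finally show ?thesis .
  qed
  ultimately show ?thesis
    using that by blast
qed

end

section \<open>Dimension, distance and locality of linear codes\<close>

lemma card_supported_functions:
  assumes "finite A"
  shows "card {c :: nat \<Rightarrow> 'a::{zero,finite}. \<forall>i. i \<notin> A \<longrightarrow> c i = 0} = CARD('a) ^ card A"
proof -
  have "bij_betw (\<lambda>f i. if i \<in> A then f i else 0) (A \<rightarrow>\<^sub>E (UNIV :: 'a set)) {c. \<forall>i. i \<notin> A \<longrightarrow> c i = 0}"
    by (rule bij_betw_byWitness[where f' = "\<lambda>c. restrict c A"])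
      (auto simp: fun_eq_iff PiE_def extensional_def)
  from bij_betw_same_card[OF this] show ?thesis
    using assms by (simp add: card_PiE)
qed

lemma finite_supported_functions:
  assumes "finite A"
  shows "finite {c :: nat \<Rightarrow> 'a::{zero,finite}. \<forall>i. i \<notin> A \<longrightarrow> c i = 0}"
  using card_supported_functions[OF assms, where 'a = 'a] by (intro card_ge_0_finite) simp

lemma words_UNIV: "words N UNIV = {c. \<forall>i. i \<notin> {..<N} \<longrightarrow> c i = 0}"
  by (auto simp: words_def)

lemma finite_words: "finite (words N (UNIV :: 'a::{zero,finite} set))"
  unfolding words_UNIV by (rule finite_supported_functions) simp

lemma card_words: "card (words N (UNIV :: 'a::{zero,finite} set)) = CARD('a) ^ N"
  unfolding words_UNIV by (subst card_supported_functions) auto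

text \<open>Each new basis vector \<open>b\<close> multiplies the size of the span by the field
  size, since \<open>b\<close> lies outside the old span.\<close>

lemma card_span_independent:
  fixes B :: "(nat \<Rightarrow> 'a::{field,finite}) set"
  assumes "finite B" "vs.independent B"
  shows "finite (vs.span B) \<and> card (vs.span B) = CARD('a) ^ card B"
  using assms
proof (induction B rule: finite_induct)
  case (insert b B)
  hence b: "b \<notin> vs.span B" and IH: "finite (vs.span B)" "card (vs.span B) = CARD('a) ^ card B"
    by (auto simp: vs.independent_insert)
  let ?f = "\<lambda>(a, v). vscale a b + v"
  have "inj_on ?f (UNIV \<times> vs.span B)"
  proof (rule inj_onI, clarify)
    fix a v a' v'
    assume *: "v \<in> vs.span B" "v' \<in> vs.span B" "vscale a b + v = vscale a' b + v'"
    have eq: "vscale (a - a') b = v' - v"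
      using *(3) by (simp add: vs.scale_left_diff_distrib algebra_simps)
    have "a = a'"
    proof (rule ccontr)
      assume "a \<noteq> a'"
      hence "b = vscale (inverse (a - a')) (v' - v)"
        by (simp add: eq[symmetric])
      also have "\<dots> \<in> vs.span B"
        using * by (intro vs.span_scale vs.span_diff)
      finally show False
        using b by simp
    qed
    thus "a = a' \<and> v = v'"
      using *(3) by simp
  qed
  moreover have "?f ` (UNIV \<times> vs.span B) = vs.span (insert b B)"
  proof (intro equalityI subsetI)
    fix x assume "x \<in> vs.span (insert b B)"
    then obtain k where "x - vscale k b \<in> vs.span B"
      by (auto simp: vs.span_insert)
    thus "x \<in> ?f ` (UNIV \<times> vs.span B)"
      by (intro image_eqI[of _ _ "(k, x - vscale k b)"]) auto
  next
    fix x assume "x \<in> ?f ` (UNIV \<times> vs.span B)"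
    then obtain a v where "v \<in> vs.span B" "x = vscale a b + v"
      by auto
    thus "x \<in> vs.span (insert b B)"
      unfolding vs.span_insert by (intro CollectI exI[of _ a]) simp
  qed
  ultimately have "card (vs.span (insert b B)) = card ((UNIV :: 'a set) \<times> vs.span B)"
      "finite (vs.span (insert b B))"
    using IH(1) card_image[of ?f "UNIV \<times> vs.span B"] finite_imageI[of "UNIV \<times> vs.span B" ?f]
    by auto
  thus ?case
    using insert IH by (simp add: card_cartesian_product)
qed simp

lemma card_linear_code:
  fixes C :: "(nat \<Rightarrow> 'a::{field,finite}) set"
  assumes "linear_code N C"
  shows "card C = CARD('a) ^ code_dim C"
proof -
  have C: "vs.subspace C" "finite C"
    using assms finite_words finite_subset by (auto simp: linear_code_def)
  obtain B where B: "B \<subseteq> C" "vs.independent B" "C \<subseteq> vs.span B" "card B = vs.dim C"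
    using vs.basis_exists[of C] by metis
  have "vs.span B = C"
    using B C vs.span_minimal by blast
  thus ?thesis
    using card_span_independent[of B] B C finite_subset by (metis code_dim_def)
qed

lemma CARD_field_gt_1: "1 < CARD('a::{field,finite})"
proof -
  have "card {0, 1::'a} \<le> CARD('a)"
    by (intro card_mono) auto
  thus ?thesis
    by simp
qed

lemma linear_code_0: "linear_code N C \<Longrightarrow> 0 \<in> C"
  and linear_code_add: "linear_code N C \<Longrightarrow> x \<in> C \<Longrightarrow> y \<in> C \<Longrightarrow> x + y \<in> C"
  and linear_code_diff: "linear_code N C \<Longrightarrow> x \<in> C \<Longrightarrow> y \<in> C \<Longrightarrow> x - y \<in> C"
  and linear_code_scale: "linear_code N C \<Longrightarrow> x \<in> C \<Longrightarrow> vscale a x \<in> C"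
  and linear_code_words: "linear_code N C \<Longrightarrow> x \<in> C \<Longrightarrow> N \<le> i \<Longrightarrow> x i = 0"
  by (auto simp: linear_code_def words_def vs.subspace_0 vs.subspace_add vs.subspace_diff
      vs.subspace_scale)

text \<open>Rank-nullity as a count: \<open>x\<close> is recovered from \<open>f x\<close> and its
  difference to a chosen representative of its fibre.\<close>

lemma card_le_kernel:
  fixes C :: "'c::group_add set"
  assumes "finite K" "finite R" "f ` C \<subseteq> R"
    and "\<And>x y. x \<in> C \<Longrightarrow> y \<in> C \<Longrightarrow> f x = f y \<Longrightarrow> x - y \<in> K"
  shows "card C \<le> card K * card R"
proof -
  define g where "g r = (SOME x. x \<in> C \<and> f x = r)" for r
  have g: "g (f x) \<in> C \<and> f (g (f x)) = f x" if "x \<in> C" for x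
    unfolding g_def by (rule someI[of _ x]) (use that in auto)
  have "card C \<le> card (K \<times> R)"
  proof (rule card_inj_on_le[where f = "\<lambda>x. (x - g (f x), f x)"])
    show "inj_on (\<lambda>x. (x - g (f x), f x)) C"
      by (rule inj_onI) (metis diff_add_cancel prod.inject)
    show "(\<lambda>x. (x - g (f x), f x)) ` C \<subseteq> K \<times> R"
      using assms g by force
  qed (use assms in auto)
  thus ?thesis
    by (simp add: card_cartesian_product)
qed

text \<open>Restriction to the coordinates in \<open>A\<close> has kernel \<open>{x \<in> C. \<forall>i\<in>A. x i = 0}\<close>.\<close>

lemma card_le_shortened_code:
  fixes C :: "(nat \<Rightarrow> 'a::{field,finite}) set"
  assumes C: "linear_code N C" and A: "finite A"
  shows "card C \<le> card {x \<in> C. \<forall>i\<in>A. x i = 0} * CARD('a) ^ card A"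
proof -
  have "finite C"
    using C finite_words finite_subset by (auto simp: linear_code_def)
  hence "card C \<le> card {x \<in> C. \<forall>i\<in>A. x i = 0} * card {c :: nat \<Rightarrow> 'a. \<forall>i. i \<notin> A \<longrightarrow> c i = 0}"
    using A finite_supported_functions[OF A, where 'a = 'a] linear_code_diff[OF C]
    by (intro card_le_kernel[where f = "\<lambda>x i. if i \<in> A then x i else 0"])
      (auto simp: fun_eq_iff split: if_splits)
  thus ?thesis
    by (simp add: card_supported_functions A)
qed

lemma code_dim_le_card:
  fixes C :: "(nat \<Rightarrow> 'a::{field,finite}) set"
  assumes C: "linear_code N C" and A: "finite A"
    and "\<And>x. x \<in> C \<Longrightarrow> (\<And>i. i \<in> A \<Longrightarrow> x i = 0) \<Longrightarrow> x = 0"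
  shows "code_dim C \<le> card A"
proof -
  have "{x \<in> C. \<forall>i\<in>A. x i = 0} \<subseteq> {0}"
    using assms(3) by blast
  from card_mono[OF _ this] have "card {x \<in> C. \<forall>i\<in>A. x i = 0} \<le> 1"
    by simp
  hence "card C \<le> 1 * CARD('a) ^ card A"
    using card_le_shortened_code[OF C A] mult_le_mono1 order_trans by blast
  thus ?thesis
    using CARD_field_gt_1[where 'a = 'a] by (simp add: card_linear_code[OF C])
qed

lemma code_dim_le_length:
  fixes C :: "(nat \<Rightarrow> 'a::{field,finite}) set"
  assumes "linear_code N C"
  shows "code_dim C \<le> N"
proof -
  have "x = 0" if "x \<in> C" "\<And>i. i \<in> {..<N} \<Longrightarrow> x i = 0" for x
    using that linear_code_words[OF assms that(1)] by (metis ext lessThan_iff not_le zero_fun_def)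
  thus ?thesis
    using code_dim_le_card[OF assms, of "{..<N}"] by simp
qed

text \<open>A codeword vanishing on the first \<open>N - (d - 1)\<close> positions has weight at
  most \<open>d - 1\<close>, so these positions determine it. For \<open>N < d - 1\<close> truncated
  subtraction correctly gives dimension 0.\<close>

lemma singleton_bound:
  fixes C :: "(nat \<Rightarrow> 'a::{field,finite}) set"
  assumes C: "linear_code N C" and d: "\<And>c. c \<in> C \<Longrightarrow> c \<noteq> 0 \<Longrightarrow> d \<le> hweight N c" "0 < d"
  shows "code_dim C \<le> N - (d - 1)"
proof -
  have "x = 0" if x: "x \<in> C" "\<And>i. i \<in> {..<N - (d - 1)} \<Longrightarrow> x i = 0" for x
  proof (rule ccontr)
    assume "x \<noteq> 0"
    hence "d \<le> hweight N x"
      using d x by blast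
    also have "\<dots> \<le> card {N - (d - 1)..<N}"
      unfolding hweight_def using x(2) by (intro card_mono) (auto simp: not_less[symmetric])
    also have "\<dots> \<le> d - 1"
      by simp
    finally show False
      using d(2) by simp
  qed
  thus ?thesis
    using code_dim_le_card[OF C, of "{..<N - (d - 1)}"] by simp
qed

section \<open>Bounds on the optimal dimension \<open>kopt\<close>\<close>

lemma finite_kopt_set:
  "finite {code_dim C | C :: (nat \<Rightarrow> 'a::{field,finite}) set.
     linear_code N C \<and> (\<forall>c\<in>C. c \<noteq> 0 \<longrightarrow> d \<le> hweight N c)}"
  by (rule finite_subset[of _ "{..N}"]) (auto intro: code_dim_le_length)

lemma kopt_ge:
  fixes C :: "(nat \<Rightarrow> 'a::{field,finite}) set"
  assumes "linear_code N C" "\<And>c. c \<in> C \<Longrightarrow> c \<noteq> 0 \<Longrightarrow> d \<le> hweight N c"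
  shows "code_dim C \<le> kopt TYPE('a) N d"
  unfolding kopt_def using assms by (intro Max_ge finite_kopt_set) blast

lemma kopt_le:
  assumes "0 < d"
  shows "kopt TYPE('a::{field,finite}) N d \<le> N - (d - 1)"
  unfolding kopt_def
proof (rule Max.boundedI[OF finite_kopt_set])
  have "linear_code N {0 :: nat \<Rightarrow> 'a}"
    by (auto simp: linear_code_def words_def)
  thus "{code_dim C | C :: (nat \<Rightarrow> 'a::{field,finite}) set.
     linear_code N C \<and> (\<forall>c\<in>C. c \<noteq> 0 \<longrightarrow> d \<le> hweight N c)} \<noteq> {}"
    by blast
qed (use singleton_bound assms in blast)

text \<open>Weights and recovery depend only on supports of codewords. Comparing \<open>D\<close>
  with \<open>quadric_code\<close> through supports, in both directions, hides the change of scalars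
  from GF(q^2) to GF(q). \<open>card_D\<close> states codimension at most 4.\<close>

locale quadric_descent = elliptic_quadric ty q \<beta> n
  for ty :: "'b::{field,finite} itself" and q :: nat and \<beta> :: "nat \<Rightarrow> 'b" and n :: nat +
  fixes D :: "(nat \<Rightarrow> 'a::{field,finite}) set"
  assumes linear: "linear_code n D"
    and card_scalars: "CARD('a) = q ^ 2"
    and card_D: "CARD('a) ^ n \<le> card D * CARD('a) ^ 4"
    and lift_word: "\<And>y. y \<in> quadric_code \<Longrightarrow> \<exists>x\<in>D. \<forall>i. x i = 0 \<longleftrightarrow> y i = 0"
    and descend_word: "\<And>x i. x \<in> D \<Longrightarrow> x i \<noteq> 0 \<Longrightarrow>
      \<exists>y\<in>quadric_code. y i \<noteq> 0 \<and> (\<forall>j. x j = 0 \<longrightarrow> y j = 0)"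
begin

lemma weight_ge_4:
  assumes "x \<in> D" "x \<noteq> 0"
  shows "4 \<le> hweight n x"
proof -
  obtain i where "x i \<noteq> 0"
    using assms(2) by (auto simp: fun_eq_iff)
  then obtain y where y: "y \<in> quadric_code" "y i \<noteq> 0" "\<forall>j. x j = 0 \<longrightarrow> y j = 0"
    using descend_word assms by blast
  have "y \<noteq> 0"
    using y(2) by auto
  hence "3 < hweight n y"
    using quadric_code_weight[OF y(1)] by (meson not_le)
  also have "hweight n y \<le> hweight n x"
    unfolding hweight_def using y(3) by (intro card_mono) auto
  finally show ?thesis
    by simp
qed

lemma min_dist_D: "min_dist n D = 4"
proof -
  obtain y where y: "y \<in> quadric_code" "y \<noteq> 0" "hweight n y \<le> 4"
    by (rule quadric_code_weight4)
  then obtain x where x: "x \<in> D" "\<forall>i. x i = 0 \<longleftrightarrow> y i = 0"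
    using lift_word by blast
  have "x \<noteq> 0"
    using x(2) y(2) by (auto simp: fun_eq_iff)
  moreover have "hweight n x = hweight n y"
    using x(2) by (simp add: hweight_def)
  ultimately have "hweight n x = 4"
    using weight_ge_4[OF x(1)] y(3) by simp
  moreover have "finite D"
    using linear finite_words finite_subset by (auto simp: linear_code_def)
  ultimately show ?thesis
    unfolding min_dist_def using x(1) \<open>x \<noteq> 0\<close> weight_ge_4
    by (intro Min_eqI) force+
qed

lemma code_dim_D: "code_dim D = n - 4"
proof (rule antisym)
  obtain J where J: "J \<subseteq> {..<n}" "card J = 4"
    "\<And>y. y \<in> quadric_code \<Longrightarrow> (\<And>j. j \<notin> J \<Longrightarrow> y j = 0) \<Longrightarrow> y = 0"
    using quadric_code_information_set by blast
  have "x = 0" if x: "x \<in> D" "\<And>i. i \<in> {..<n} - J \<Longrightarrow> x i = 0" for x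
  proof (rule ccontr)
    assume "x \<noteq> 0"
    then obtain i where "x i \<noteq> 0"
      by (auto simp: fun_eq_iff)
    then obtain y where y: "y \<in> quadric_code" "y i \<noteq> 0" "\<forall>j. x j = 0 \<longrightarrow> y j = 0"
      using descend_word x by blast
    have "x j = 0" if "j \<notin> J" for j
      using that x linear_code_words[OF linear x(1)] by (cases "j < n") auto
    hence "y = 0"
      using y by (intro J(3)) auto
    thus False
      using y(2) by simp
  qed
  hence "code_dim D \<le> card ({..<n} - J)"
    by (intro code_dim_le_card[OF linear]) auto
  thus "code_dim D \<le> n - 4"
    using J by (simp add: card_Diff_subset finite_subset)
next
  have "CARD('a) ^ n \<le> CARD('a) ^ (code_dim D + 4)"
    using card_D by (simp add: card_linear_code[OF linear] power_add)
  thus "n - 4 \<le> code_dim D"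
    using CARD_field_gt_1[where 'a = 'a] by simp
qed

lemma local_recovery_set:
  assumes "i < n"
  obtains J where "J \<subseteq> {..<n}" "card J = q + 1" "i \<notin> J"
    "\<And>x. x \<in> D \<Longrightarrow> (\<And>j. j \<in> {..<n} - insert i J \<Longrightarrow> x j = 0) \<Longrightarrow> x i = 0"
proof -
  obtain J where J: "J \<subseteq> {..<n}" "card J = q + 1" "i \<notin> J"
    "\<And>y. y \<in> quadric_code \<Longrightarrow> (\<And>j. j \<notin> insert i J \<Longrightarrow> y j = 0) \<Longrightarrow> y i = 0"
    using quadric_code_local_recovery[OF assms] by blast
  have "x i = 0" if x: "x \<in> D" "\<And>j. j \<in> {..<n} - insert i J \<Longrightarrow> x j = 0" for x
  proof (rule ccontr)
    assume "x i \<noteq> 0"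
    then obtain y where y: "y \<in> quadric_code" "y i \<noteq> 0" "\<forall>j. x j = 0 \<longrightarrow> y j = 0"
      using descend_word x by blast
    have "x j = 0" if "j \<notin> insert i J" for j
      using that x linear_code_words[OF linear x(1)] by (cases "j < n") auto
    thus False
      using y J(4) by blast
  qed
  thus ?thesis
    using that J by blast
qed

lemma card_recovery_set:
  assumes "i < n" "J \<subseteq> {..<n}" "card J = q + 1" "i \<notin> J"
  shows "card ({..<n} - insert i J) = q ^ 2 - q - 1"
proof -
  have "finite J"
    using assms(2) finite_subset by blast
  hence "card ({..<n} - insert i J) = n - (q + 2)"
    using assms by (subst card_Diff_subset) auto
  thus ?thesis
    by (simp add: n_def)
qed

lemma has_locality_D: "has_locality n D (q ^ 2 - q - 1)"
  unfolding has_locality_def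
proof (intro allI impI)
  fix i assume i: "i < n"
  obtain J where J: "J \<subseteq> {..<n}" "card J = q + 1" "i \<notin> J"
    "\<And>x. x \<in> D \<Longrightarrow> (\<And>j. j \<in> {..<n} - insert i J \<Longrightarrow> x j = 0) \<Longrightarrow> x i = 0"
    using local_recovery_set[OF i] by blast
  define S where "S = {..<n} - insert i J"
  \<comment> \<open>The choice is immaterial: two codewords that agree on \<open>S\<close> differ by
    one vanishing on \<open>S\<close>, hence at \<open>i\<close>.\<close>
  define f where "f g = (SOME a. \<exists>c\<in>D. g = (\<lambda>j. if j \<in> S then c j else undefined) \<and> a = c i)" for g
  have "c i = f (\<lambda>j. if j \<in> S then c j else undefined)" if c: "c \<in> D" for c
  proof -
    let ?g = "\<lambda>j. if j \<in> S then c j else undefined"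
    have "\<exists>c'\<in>D. ?g = (\<lambda>j. if j \<in> S then c' j else undefined) \<and> f ?g = c' i"
      unfolding f_def by (rule someI_ex) (use c in blast)
    then obtain c' where c': "c' \<in> D" "?g = (\<lambda>j. if j \<in> S then c' j else undefined)" "f ?g = c' i"
      by blast
    have "(c - c') j = 0" if "j \<in> S" for j
      using fun_cong[OF c'(2), of j] that by simp
    hence "(c - c') i = 0"
      using linear_code_diff[OF linear c c'(1)] J(4)[of "c - c'"] by (simp add: S_def)
    thus ?thesis
      using c'(3) by simp
  qed
  moreover have "S \<subseteq> {0..<n} - {i}"
    by (auto simp: S_def)
  moreover have "card S = q ^ 2 - q - 1"
    unfolding S_def by (rule card_recovery_set[OF i J(1-3)])
  ultimately have "coord_locality n D i (q ^ 2 - q - 1)"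
    unfolding coord_locality_def by blast
  thus "\<exists>r'\<le>q ^ 2 - q - 1. coord_locality n D i r'"
    by blast
qed

text \<open>For smaller \<open>r\<close> at least \<open>q + 2\<close> points remain outside
  \<open>insert i S\<close>. Some codeword then agrees with the zero word on \<open>S\<close> but
  not at \<open>i\<close>, which excludes every recovery function, linear or not.\<close>

lemma coord_locality_ge:
  assumes "i < n" "coord_locality n D i r"
  shows "q ^ 2 - q - 1 \<le> r"
proof (rule ccontr)
  assume less: "\<not> ?thesis"
  obtain S f where S: "S \<subseteq> {0..<n} - {i}" "card S = r"
    "\<forall>c\<in>D. c i = f (\<lambda>j. if j \<in> S then c j else undefined)"
    using assms(2) unfolding coord_locality_def by blast
  define T where "T = {..<n} - insert i S"
  have "finite S"
    using S finite_subset by blast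
  hence "card T = n - (r + 1)"
    unfolding T_def using S assms(1) by (subst card_Diff_subset) (auto simp: card_insert_if)
  hence "q + 2 \<le> card T"
    using less by (simp add: n_def)
  then obtain y where y: "y \<in> quadric_code" "y i \<noteq> 0" "\<And>j. j \<notin> insert i T \<Longrightarrow> y j = 0"
    using quadric_code_recovery[of T i] assms(1) by (auto simp: T_def)
  then obtain x where x: "x \<in> D" "\<forall>j. x j = 0 \<longleftrightarrow> y j = 0"
    using lift_word by blast
  have "x j = 0" if "j \<in> S" for j
    using that S x(2) y(3)[of j] by (auto simp: T_def)
  hence "(\<lambda>j. if j \<in> S then x j else undefined) = (\<lambda>j. if j \<in> S then (0 :: nat \<Rightarrow> 'a) j else undefined)"
    by auto
  hence "x i = (0 :: nat \<Rightarrow> 'a) i"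
    using S(3) x(1) linear_code_0[OF linear] by metis
  thus False
    using x(2) y(2) by simp
qed

lemma locality_D: "locality n D = q ^ 2 - q - 1"
  unfolding locality_def
proof (rule Least_equality)
  show "has_locality n D (q ^ 2 - q - 1)"
    by (rule has_locality_D)
next
  fix r assume "has_locality n D r"
  moreover have "0 < n"
    by (simp add: n_def)
  ultimately obtain r' where "r' \<le> r" "coord_locality n D 0 r'"
    unfolding has_locality_def by blast
  thus "q ^ 2 - q - 1 \<le> r"
    using coord_locality_ge[OF \<open>0 < n\<close>] order_trans by blast
qed

text \<open>\<open>D\<close> is shortened on a recovery set \<open>S\<close> of position 0. Entry 0
  then vanishes too, so only the \<open>q + 1\<close> positions of \<open>J\<close> remain, with
  dimension at least \<open>(n - 4) - card S = q - 2\<close>.\<close>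

lemma kopt_shortened: "q - 2 \<le> kopt TYPE('a) (q + 1) 4"
proof -
  have "0 < n"
    by (simp add: n_def)
  obtain J where J: "J \<subseteq> {..<n}" "card J = q + 1" "0 \<notin> J"
    "\<And>x. x \<in> D \<Longrightarrow> (\<And>j. j \<in> {..<n} - insert 0 J \<Longrightarrow> x j = 0) \<Longrightarrow> x 0 = 0"
    using local_recovery_set[OF \<open>0 < n\<close>] by blast
  define S where "S = {..<n} - insert 0 J"
  have card_S: "card S = q ^ 2 - q - 1"
    unfolding S_def by (rule card_recovery_set[OF \<open>0 < n\<close> J(1-3)])
  define K where "K = {x \<in> D. \<forall>i\<in>S. x i = 0}"
  have K_supp: "x j = 0" if "x \<in> K" "j \<notin> J" for x j
    using that J(4)[of x] linear_code_words[OF linear, of x j]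
    by (cases "j < n"; cases "j = 0") (auto simp: K_def S_def)
  have "finite J"
    using J(1) finite_subset by blast
  then obtain e where e: "bij_betw e {0..<q + 1} J"
    using ex_bij_betw_nat_finite J(2) by metis
  define g :: "(nat \<Rightarrow> 'a) \<Rightarrow> nat \<Rightarrow> 'a" where "g x k = (if k < q + 1 then x (e k) else 0)" for x k
  have inj: "inj_on g K"
  proof (rule inj_onI, rule ext)
    fix x y j assume *: "x \<in> K" "y \<in> K" "g x = g y"
    show "x j = y j"
    proof (cases "j \<in> J")
      case True
      then obtain k where "k < q + 1" "j = e k"
        using e by (auto simp: bij_betw_def)
      thus ?thesis
        using fun_cong[OF *(3), of k] by (simp add: g_def)
    next
      case False
      thus ?thesis
        using K_supp[OF *(1)] K_supp[OF *(2)] by simp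
    qed
  qed
  have K0: "0 \<in> K"
    using linear_code_0[OF linear] by (simp add: K_def)
  have Kadd: "x + y \<in> K" if "x \<in> K" "y \<in> K" for x y
    using that linear_code_add[OF linear] by (simp add: K_def)
  have Kscale: "vscale a x \<in> K" if "x \<in> K" for a x
    using that linear_code_scale[OF linear] by (simp add: K_def) (simp add: vscale_def)
  have g0: "g 0 = 0" and gadd: "g x + g y = g (x + y)" and gscale: "vscale a (g x) = g (vscale a x)"
    for x y a
    by (auto simp: g_def vscale_def fun_eq_iff)
  have lin: "linear_code (q + 1) (g ` K)"
    unfolding linear_code_def vs.subspace_def
  proof (intro conjI ballI allI)
    show "g ` K \<subseteq> words (q + 1) UNIV"
      by (auto simp: words_def g_def)
    show "0 \<in> g ` K"
      using K0 g0 by (metis imageI)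
    show "x + y \<in> g ` K" if "x \<in> g ` K" "y \<in> g ` K" for x y
      using that Kadd gadd by auto
    show "vscale a x \<in> g ` K" if "x \<in> g ` K" for a x
      using that Kscale gscale by auto
  qed
  have weight: "4 \<le> hweight (q + 1) c" if "c \<in> g ` K" "c \<noteq> 0" for c
  proof -
    obtain x where x: "x \<in> K" "c = g x"
      using \<open>c \<in> g ` K\<close> by blast
    have "x \<noteq> 0"
      using x(2) g0 \<open>c \<noteq> 0\<close> by metis
    hence "4 \<le> hweight n x"
      using weight_ge_4 x(1) by (simp add: K_def)
    also have "{i. i < n \<and> x i \<noteq> 0} \<subseteq> e ` {k. k < q + 1 \<and> c k \<noteq> 0}"
    proof
      fix i assume i: "i \<in> {i. i < n \<and> x i \<noteq> 0}"
      hence "i \<in> e ` {0..<q + 1}"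
        using K_supp[OF x(1)] e by (auto simp: bij_betw_def)
      then obtain k where "k < q + 1" "i = e k"
        by auto
      thus "i \<in> e ` {k. k < q + 1 \<and> c k \<noteq> 0}"
        using i by (auto simp: x(2) g_def)
    qed
    hence "hweight n x \<le> hweight (q + 1) c"
      unfolding hweight_def by (rule surj_card_le[rotated]) simp
    finally show ?thesis .
  qed
  have "CARD('a) ^ (n - 4) \<le> card K * CARD('a) ^ card S"
    using card_le_shortened_code[OF linear, of S] code_dim_D
    by (simp add: card_linear_code[OF linear] K_def S_def)
  also have "card K = CARD('a) ^ code_dim (g ` K)"
    using card_image[OF inj] card_linear_code[OF lin] by simp
  finally have "CARD('a) ^ (n - 4) \<le> CARD('a) ^ (code_dim (g ` K) + card S)"
    by (simp add: power_add)
  hence "n - 4 \<le> code_dim (g ` K) + card S"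
    using CARD_field_gt_1[where 'a = 'a] by simp
  moreover have "3 * q \<le> q ^ 2"
    using q_gt2 by (simp add: power2_eq_square)
  ultimately have "q - 2 \<le> code_dim (g ` K)"
    using card_S q_gt2 by (simp add: n_def)
  also have "\<dots> \<le> kopt TYPE('a) (q + 1) 4"
    using lin weight by (rule kopt_ge)
  finally show ?thesis .
qed

text \<open>As \<open>2 * (q ^ 2 - q) > n\<close>, only \<open>t = 0\<close> and
  \<open>t = 1\<close> are admissible. \<open>D\<close> itself bounds the first term below by
  \<open>n - 4\<close>; the Singleton bound and the shortened code make the second equal to
  it.\<close>

lemma dimension_optimal_D: "dimension_optimal TYPE('a) n (n - 4) 4 (q ^ 2 - q - 1)"
proof -
  let ?r = "q ^ 2 - q - 1"
  let ?f = "\<lambda>t. t * ?r + kopt TYPE('a) (n - t * (?r + 1)) 4"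
  have q2: "3 * q \<le> q ^ 2"
    using q_gt2 by (simp add: power2_eq_square)
  have t: "t * (?r + 1) \<le> n \<longleftrightarrow> t = 0 \<or> t = 1" for t
  proof
    assume *: "t * (?r + 1) \<le> n"
    show "t = 0 \<or> t = 1"
    proof (rule ccontr)
      assume "\<not> ?thesis"
      hence "2 * (?r + 1) \<le> t * (?r + 1)"
        by (intro mult_le_mono1) auto
      thus False
        using * q2 q_gt2 by (simp add: n_def)
    qed
  qed (auto simp: n_def)
  have "{t. t * (?r + 1) \<le> n} = {0, 1}"
    unfolding t by blast
  hence "{?f t | t. t * (?r + 1) \<le> n} = {?f 0, ?f 1}"
    by (simp only: setcompr_eq_image image_insert image_empty)
  moreover have "n - 4 \<le> ?f 0"
    using kopt_ge[OF linear weight_ge_4] by (simp add: code_dim_D)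
  moreover have "?f 1 = n - 4"
  proof -
    have "n - 1 * (?r + 1) = q + 1"
      using q2 q_gt2 by (simp add: n_def)
    moreover have "kopt TYPE('a) (q + 1) 4 = q - 2"
      using kopt_le[of 4 "q + 1", where 'a = 'a] kopt_shortened by simp
    ultimately show ?thesis
      using q2 q_gt2 by (simp add: n_def)
  qed
  ultimately have "Min {?f t | t. t * (?r + 1) \<le> n} = n - 4"
    by (simp add: min_def)
  thus ?thesis
    unfolding dimension_optimal_def by simp
qed

text \<open>Since \<open>r < k \<le> 2 * r\<close>, the ceiling is 2 and the bound becomes
  \<open>n - k = 4\<close>.\<close>

lemma distance_optimal_D: "distance_optimal n (n - 4) 4 (q ^ 2 - q - 1)"
proof -
  define k r where "k = real (n - 4)" and "r = real (q ^ 2 - q - 1)"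
  have q2: "3 * q \<le> q ^ 2"
    using q_gt2 by (simp add: power2_eq_square)
  have k: "k = real q ^ 2 - 3" and r: "r = real q ^ 2 - real q - 1"
    using q2 q_gt2 by (simp_all add: k_def r_def n_def of_nat_diff)
  have q2': "3 * real q \<le> real q ^ 2"
    using q2 by (metis of_nat_le_iff of_nat_mult of_nat_numeral of_nat_power)
  have "0 < r" "r < k"
    using q_gt2 q2' by (simp_all add: k r)
  moreover have "k \<le> 2 * r"
    using q_gt2 q2' by (simp add: k r)
  ultimately have "\<lceil>k / r\<rceil> = 2"
    by (intro ceiling_unique) (simp_all add: field_simps)
  thus ?thesis
    using q2 q_gt2 unfolding distance_optimal_def k_def r_def by (simp add: n_def)
qed

theorem distance_and_dimension_optimal:
  "distance_optimal n (code_dim D) (min_dist n D) (locality n D) \<and>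
   dimension_optimal TYPE('a) n (code_dim D) (min_dist n D) (locality n D)"
  using distance_optimal_D dimension_optimal_D by (simp add: code_dim_D min_dist_D locality_D)

end

section \<open>Duals of constacyclic codes\<close>

lemma has_order_imp_dvd:
  fixes x :: "'b::field"
  assumes "has_order x k" "x ^ j = 1"
  shows "k dvd j"
proof (rule ccontr)
  assume "\<not> k dvd j"
  have "x ^ j = (x ^ k) ^ (j div k) * x ^ (j mod k)"
    by (simp flip: power_mult power_add)
  hence "x ^ (j mod k) = 1"
    using assms by (simp add: has_order_def)
  moreover have "0 < j mod k" "j mod k < k"
    using assms \<open>\<not> k dvd j\<close> by (auto simp: has_order_def dvd_eq_mod_eq_0)
  ultimately show False
    using assms by (auto simp: has_order_def)
qed

text \<open>The 2-adic condition makes \<open>w / r\<close> odd. As the gcd of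
  \<open>q ^ 2 + 1\<close> and \<open>q ^ 2 - 1\<close> divides 2, \<open>q ^ 2 + 1\<close> is
  coprime to both \<open>q\<close> and \<open>w / r\<close>.\<close>

lemma dvd_of_order_dvd:
  fixes q r w d :: nat
  assumes "1 < q" "r dvd w" "w = q + 1 \<or> w = q - 1" "multiplicity 2 r = multiplicity 2 w"
    and "r * (q ^ 2 + 1) dvd q * w * d"
  shows "q ^ 2 + 1 dvd d"
proof -
  obtain w' where w': "w = r * w'"
    using assms(2) by blast
  have "w \<noteq> 0"
    using assms by auto
  hence nz: "r \<noteq> 0" "w' \<noteq> 0"
    using w' by auto
  have "odd w'"
  proof
    assume "even w'"
    hence "multiplicity 2 w' \<noteq> 0"
      using nz by (simp add: multiplicity_eq_zero_iff)
    moreover have "multiplicity 2 w = multiplicity 2 r + multiplicity 2 w'"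
      unfolding w' using nz by (intro prime_elem_multiplicity_mult_distrib) auto
    ultimately show False
      using assms(4) by simp
  qed
  have "coprime (q ^ 2 + 1) q"
  proof (rule coprimeI)
    fix c assume "c dvd q ^ 2 + 1" "c dvd q"
    thus "is_unit c"
      using dvd_add_right_iff[of c "q ^ 2" 1] by (simp add: power2_eq_square)
  qed
  moreover have "coprime (q ^ 2 + 1) w'"
  proof (rule coprimeI)
    fix c assume c: "c dvd q ^ 2 + 1" "c dvd w'"
    have "w dvd (q + 1) * (q - 1)"
      using assms(3) by (metis dvd_triv_left dvd_triv_right)
    hence "c dvd (q + 1) * (q - 1)"
      using c(2) w' by (meson dvd_trans dvd_triv_right)
    moreover have "(q + 1) * (q - 1) + 2 = q ^ 2 + 1"
      using assms(1) by (simp add: algebra_simps power2_eq_square diff_mult_distrib2)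
    ultimately have "c dvd 2"
      using c(1) by (metis dvd_add_right_iff)
    hence "c = 1 \<or> c = 2"
      by (metis prime_nat_iff two_is_prime_nat)
    thus "is_unit c"
      using c(2) \<open>odd w'\<close> by auto
  qed
  moreover have "r * (q ^ 2 + 1) dvd r * (q * (w' * d))"
    using assms(5) unfolding w' by (simp only: mult_ac)
  hence "q ^ 2 + 1 dvd q * (w' * d)"
    using nz(1) by (simp only: nat_mult_dvd_cancel_disj) simp
  ultimately show ?thesis
    by (simp add: coprime_dvd_mult_right_iff)
qed

lemma poly_check_poly_eq_0_iff:
  "poly (check_poly \<delta> es) t = 0 \<longleftrightarrow> (\<exists>e\<in>set es. t = \<delta> ^ e)"
  unfolding check_poly_def by (induction es) auto

lemma linear_factor_dvd_check_poly:
  "e \<in> set es \<Longrightarrow> [:- (\<delta> ^ e), 1:] dvd check_poly \<delta> es"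
  unfolding check_poly_def
  by (induction es) (auto simp del: mult_pCons_left intro: dvd_mult)

lemma sum_powers_root_of_unity:
  fixes z :: "'b::field"
  assumes "z ^ n = 1"
  shows "(\<Sum>k<n. z ^ k) = (if z = 1 then of_nat n else 0)"
  using assms power_diff_1_eq[of z n] by auto

text \<open>Up to a unit, this word is the quotient of \<open>X ^ n - b ^ n\<close> by \<open>X - b\<close>.\<close>

lemma constacyclic_dvd_power_word:
  fixes b :: "'b::field"
  assumes "b \<noteq> 0"
  shows "(monom 1 n - [:b ^ n:]) dvd (\<Sum>i<n. monom (inverse b ^ i) i) * [:- b, 1:]"
proof -
  define u where "u = [:0, inverse b:]"
  have u: "u ^ i = monom (inverse b ^ i) i" for i
    by (induction i) (auto simp: u_def monom_Suc monom_0 mult.commute simp flip: one_pCons smult_monom)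
  have "smult b (u - 1) = [:- b, 1:]"
    using assms by (simp add: u_def one_pCons)
  hence "(\<Sum>i<n. monom (inverse b ^ i) i) * [:- b, 1:] = smult b ((u - 1) * (\<Sum>i<n. u ^ i))"
    by (simp add: u mult.commute flip: mult_smult_left)
  also have "(u - 1) * (\<Sum>i<n. u ^ i) = u ^ n - 1"
    by (rule power_diff_1_eq[symmetric])
  also have "\<dots> = smult (inverse b ^ n) (monom 1 n - [:b ^ n:])"
    using assms by (simp add: u smult_diff_right smult_monom power_inverse one_pCons)
  finally have "(\<Sum>i<n. monom (inverse b ^ i) i) * [:- b, 1:]
      = smult (b * inverse b ^ n) (monom 1 n - [:b ^ n:])"
    by (simp only: smult_smult)
  thus ?thesis
    by (simp only: dvd_smult dvd_refl)
qed

lemma linear_code_dual: "linear_code n (dual_code n C)"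
  unfolding linear_code_def vs.subspace_def dual_code_def words_def
  by (auto simp: vscale_def distrib_right sum.distrib mult.assoc simp flip: sum_distrib_left)

locale subfield_embedding = quartic_frobenius ty q
  for ty :: "'b::{field,finite} itself" and q :: nat +
  fixes emb :: "'a::{field,finite} \<Rightarrow> 'b"
  assumes emb: "field_emb emb"
    and card_subfield: "CARD('a) = q ^ 2"
begin

lemma inj_emb: "inj emb"
  and emb_1 [simp]: "emb 1 = 1"
  and emb_add [simp]: "emb (x + y) = emb x + emb y"
  and emb_mult [simp]: "emb (x * y) = emb x * emb y"
  using emb by (auto simp: field_emb_def)

lemma emb_0 [simp]: "emb 0 = 0"
  using emb_add[of 0 0] by (metis add.right_neutral add_left_cancel)

lemma emb_eq_0_iff [simp]: "emb x = 0 \<longleftrightarrow> x = 0"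
  using inj_emb emb_0 by (metis injD)

lemma emb_power: "emb (x ^ k) = emb x ^ k"
  by (induction k) auto

lemma emb_sum: "emb (sum f A) = (\<Sum>i\<in>A. emb (f i))"
  by (induction A rule: infinite_finite_induct) auto

lemma frob2_emb [simp]: "frob (frob (emb x)) = emb x"
  using finite_field_power_card[of x]
  by (simp add: frob2_power card_subfield flip: emb_power)

lemma card_range_emb: "card (range emb) = q ^ 2"
  using card_image[OF inj_emb] card_subfield by simp

text \<open>The image consists of \<open>q ^ 2\<close> solutions, as many as an equation of this
  degree can have.\<close>

lemma range_emb_iff: "x \<in> range emb \<longleftrightarrow> frob (frob x) = x"
proof -
  have "card {x. frob (frob x) = x} \<le> q ^ 2"
  proof (rule ccontr)
    assume *: "\<not> ?thesis"
    have "1 < q ^ 2"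
      using q_gt2 one_less_power[of q 2] by simp
    thus False
      using exists_not_root_binomial[of 1 "q ^ 2" "{x. frob (frob x) = x}" "-1"] *
      by (auto simp: frob2_power)
  qed
  hence "range emb = {x. frob (frob x) = x}"
    using card_range_emb by (intro card_seteq) auto
  thus ?thesis
    by auto
qed

text \<open>u X^q + v X has at most \<open>q\<close> roots, fewer than GF(q^2) has elements. This
  serves both Hilbert 90 and the descent of words to \<open>Fq\<close>.\<close>

lemma exists_twisted_trace_nonzero:
  assumes "u \<noteq> 0"
  obtains c where "frob (frob c) = c" "u * frob c + v * c \<noteq> 0"
proof -
  have "1 * 1 < q * q" "q * 1 < q * q"
    using q_gt2 by (intro mult_strict_mono mult_strict_left_mono; simp)+
  hence "q < card (range emb)"
    by (simp add: card_range_emb power2_eq_square)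
  then obtain c where "c \<in> range emb" "u * c ^ q + v * c \<noteq> 0"
    using exists_not_root_binomial[of u q "range emb" v] assms q_gt2 by auto
  thus ?thesis
    using that[of c] by (auto simp: frob_def[symmetric] range_emb_iff)
qed

definition word_eval :: "nat \<Rightarrow> (nat \<Rightarrow> 'a) \<Rightarrow> 'b \<Rightarrow> 'b" where
  "word_eval n x a = (\<Sum>i<n. emb (x i) * a ^ i)"

text \<open>Zeros come in conjugate pairs over GF(q^2), which reduces the four exponents of the
  check polynomial to two parity checks.\<close>

lemma frob2_word_eval: "frob (frob (word_eval n x a)) = word_eval n x (frob (frob a))"
  by (simp add: word_eval_def frob_sum frob_power)

lemma word_eval_diff: "word_eval n (x - y) a = word_eval n x a - word_eval n y a"
proof -
  have "emb (x i - y i) = emb (x i) - emb (y i)" for i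
    using emb_add[of "x i - y i" "y i"] by simp
  thus ?thesis
    by (simp add: word_eval_def left_diff_distrib sum_subtractf)
qed

lemma word_eval_scale_sum:
  "(\<Sum>i<n. emb (x i) * (a * y ^ i)) = a * word_eval n x y"
  by (simp add: word_eval_def sum_distrib_left mult.left_commute)

lemma poly_word: "poly (\<Sum>i<n. monom (emb (c i)) i) t = word_eval n c t"
  by (simp add: word_eval_def poly_sum poly_monom)

text \<open>By Fourier inversion over the roots \<open>\<delta> \<omega> ^ k\<close> of \<open>X ^ n - \<lambda>\<close>, a codeword is a combination
  of the words \<open>\<beta> ^ - i\<close> with \<open>\<beta>\<close> a root of the check polynomial.\<close>

lemma mem_dual_if_word_eval_0:
  fixes \<omega> :: 'b
  assumes \<delta>: "\<delta> ^ n = emb lam" "\<delta> \<noteq> 0"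
    and \<omega>: "\<omega> ^ n = 1" "\<And>j. 0 < j \<Longrightarrow> j < n \<Longrightarrow> \<omega> ^ j \<noteq> 1"
    and n: "of_nat n \<noteq> (0::'b)"
    and x: "x \<in> words n UNIV" "\<And>e. e \<in> set es \<Longrightarrow> word_eval n x (inverse (\<delta> ^ e)) = 0"
  shows "x \<in> dual_code n (constacyclic_code_check emb n lam (check_poly \<delta> es))"
proof -
  have "(\<Sum>i<n. x i * c i) = 0"
    if c: "c \<in> constacyclic_code_check emb n lam (check_poly \<delta> es)" for c
  proof -
    define t where "t k = \<delta> * \<omega> ^ k" for k
    have \<omega>0: "\<omega> \<noteq> 0"
      using \<omega>(1) n by (cases n) auto
    have inv: "(\<Sum>k<n. word_eval n c (t k) * inverse (t k) ^ i) = of_nat n * emb (c i)" if i: "i < n" for i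
    proof -
      have "(\<Sum>k<n. word_eval n c (t k) * inverse (t k) ^ i)
          = (\<Sum>k<n. \<Sum>l<n. emb (c l) * (\<delta> ^ l * inverse \<delta> ^ i) * (\<omega> ^ l * inverse \<omega> ^ i) ^ k)"
        unfolding word_eval_def sum_distrib_right
        by (intro sum.cong refl)
          (simp add: t_def power_mult_distrib power_inverse mult_ac flip: power_mult)
      also have "\<dots> = (\<Sum>l<n. emb (c l) * (\<delta> ^ l * inverse \<delta> ^ i) * (\<Sum>k<n. (\<omega> ^ l * inverse \<omega> ^ i) ^ k))"
        by (subst sum.swap) (simp add: sum_distrib_left)
      also have "\<dots> = (\<Sum>l<n. if l = i then of_nat n * emb (c i) else 0)"
      proof (rule sum.cong[OF refl])
        fix l assume "l \<in> {..<n}"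
        hence l: "l < n" by simp
        let ?z = "\<omega> ^ l * inverse \<omega> ^ i"
        have "?z ^ n = (\<omega> ^ n) ^ l * inverse (\<omega> ^ n) ^ i"
          by (simp add: power_mult_distrib mult.commute power_inverse flip: power_mult)
        hence zn: "?z ^ n = 1"
          using \<omega>(1) by simp
        have z1: "?z = 1 \<longleftrightarrow> l = i"
        proof
          assume "?z = 1"
          hence eq: "\<omega> ^ l = \<omega> ^ i"
            using \<omega>0 by (simp add: field_simps power_inverse)
          show "l = i"
          proof (rule ccontr)
            assume "l \<noteq> i"
            define a b where "a = min l i" and "b = max l i"
            have "\<omega> ^ b = \<omega> ^ a" "a < b" "b < n"
              using eq \<open>l \<noteq> i\<close> l i by (auto simp: a_def b_def min_def max_def)
            hence "\<omega> ^ a * \<omega> ^ (b - a) = \<omega> ^ a * 1"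
              by (simp flip: power_add)
            hence "\<omega> ^ (b - a) = 1"
              using \<omega>0 by simp
            thus False
              using \<omega>(2)[of "b - a"] \<open>a < b\<close> \<open>b < n\<close> by simp
          qed
        qed (use \<omega>0 in \<open>simp add: power_inverse\<close>)
        show "emb (c l) * (\<delta> ^ l * inverse \<delta> ^ i) * (\<Sum>k<n. ?z ^ k)
            = (if l = i then of_nat n * emb (c i) else 0)"
          unfolding sum_powers_root_of_unity[OF zn] z1 using \<delta>(2)
          by (simp add: power_inverse)
      qed
      also have "\<dots> = of_nat n * emb (c i)"
        using i by simp
      finally show ?thesis .
    qed
    \<comment> \<open>A root \<open>t k\<close> at which \<open>c\<close> does not vanish is a root
      of the check polynomial, and there the second factor is 0.\<close>
    have zero: "word_eval n c (t k) * word_eval n x (inverse (t k)) = 0" for k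
    proof -
      have "(\<omega> ^ k) ^ n = (\<omega> ^ n) ^ k"
        by (simp add: mult.commute flip: power_mult)
      hence "t k ^ n = emb lam"
        using \<delta> \<omega> by (simp add: t_def power_mult_distrib)
      hence "poly (monom 1 n - [:emb lam:]) (t k) = 0"
        by (simp add: poly_monom)
      moreover obtain f where
        "(\<Sum>i<n. monom (emb (c i)) i) * check_poly \<delta> es = (monom 1 n - [:emb lam:]) * f"
        using c unfolding constacyclic_code_check_def by (blast elim: dvdE)
      ultimately have "poly ((\<Sum>i<n. monom (emb (c i)) i) * check_poly \<delta> es) (t k) = 0"
        by (simp only: poly_mult mult_zero_left)
      hence "word_eval n c (t k) = 0 \<or> (\<exists>e\<in>set es. t k = \<delta> ^ e)"
        by (simp add: poly_word poly_check_poly_eq_0_iff)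
      thus ?thesis
        using x(2) by auto
    qed
    have "of_nat n * emb (\<Sum>i<n. x i * c i)
        = (\<Sum>i<n. emb (x i) * (of_nat n * emb (c i)))"
      by (simp add: emb_sum sum_distrib_left mult.left_commute)
    also have "\<dots> = (\<Sum>i<n. \<Sum>k<n. emb (x i) * (word_eval n c (t k) * inverse (t k) ^ i))"
      by (simp add: inv[symmetric] sum_distrib_left)
    also have "\<dots> = (\<Sum>k<n. \<Sum>i<n. emb (x i) * (word_eval n c (t k) * inverse (t k) ^ i))"
      by (rule sum.swap)
    also have "\<dots> = 0"
      by (simp add: word_eval_scale_sum zero)
    finally show ?thesis
      using n by simp
  qed
  thus ?thesis
    using x(1) by (simp add: dual_code_def)
qed

text \<open>The trace words \<open>Tr(a b ^ - i)\<close> lie in the code, and the trace form is nondegenerate.\<close>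

lemma word_eval_0_if_mem_dual:
  assumes x: "x \<in> dual_code n (constacyclic_code_check emb n lam (check_poly \<delta> es))"
    and es: "e \<in> set es" "e * q ^ 2 \<in> set es"
    and b: "(\<delta> ^ e) ^ n = emb lam" "\<delta> \<noteq> 0"
  shows "word_eval n x (inverse (\<delta> ^ e)) = 0"
proof (rule ccontr)
  define b where "b = \<delta> ^ e"
  define s where "s = word_eval n x (inverse b)"
  assume "\<not> ?thesis"
  hence "s \<noteq> 0"
    by (simp add: s_def b_def)
  have b': "b \<noteq> 0" "b ^ n = emb lam" "frob (frob b) = \<delta> ^ (e * q ^ 2)"
    using assms by (auto simp: b_def frob2_power simp flip: power_mult)
  \<comment> \<open>Pairing \<open>x\<close> with the trace word of \<open>a\<close> yields the
    trace of \<open>a * s\<close> to GF(q^2).\<close>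
  have orth: "a * s + frob (frob (a * s)) = 0" for a
  proof -
    let ?w = "\<lambda>i. a * inverse b ^ i + frob (frob (a * inverse b ^ i))"
    have "frob (frob (?w i)) = ?w i" for i
      by simp
    hence "\<forall>i. \<exists>c. emb c = ?w i"
      using range_emb_iff by (metis imageE)
    then obtain c0 where c0: "\<And>i. emb (c0 i) = ?w i"
      by metis
    define c where "c i = (if i < n then c0 i else 0)" for i
    let ?G = "\<lambda>b. \<Sum>i<n. monom (inverse b ^ i) i"
    have "(\<Sum>i<n. monom (emb (c i)) i) = smult a (?G b) + smult (frob (frob a)) (?G (frob (frob b)))"
      by (intro poly_eqI) (simp add: coeff_sum c_def c0 frob_power)
    moreover have "(monom 1 n - [:emb lam:]) dvd ?G b * check_poly \<delta> es"
    proof -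
      have "(monom 1 n - [:emb lam:]) dvd ?G b * [:- b, 1:]"
        using constacyclic_dvd_power_word[of b n] b' by simp
      also have "\<dots> dvd ?G b * check_poly \<delta> es"
        using linear_factor_dvd_check_poly[OF es(1)] by (intro mult_dvd_mono) (auto simp: b_def)
      finally show ?thesis .
    qed
    moreover have "(monom 1 n - [:emb lam:]) dvd ?G (frob (frob b)) * check_poly \<delta> es"
    proof -
      have fb: "frob (frob b) ^ n = emb lam"
        using b'(2) frob2_emb[of lam] by (metis frob_power)
      have "frob (frob b) \<noteq> 0"
        using b'(1) by simp
      hence "(monom 1 n - [:emb lam:]) dvd ?G (frob (frob b)) * [:- frob (frob b), 1:]"
        using constacyclic_dvd_power_word[of "frob (frob b)" n] by (simp only: fb simp_thms)
      also have "\<dots> dvd ?G (frob (frob b)) * check_poly \<delta> es"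
        using linear_factor_dvd_check_poly[OF es(2)] b'(3) by (intro mult_dvd_mono) auto
      finally show ?thesis .
    qed
    ultimately have "c \<in> constacyclic_code_check emb n lam (check_poly \<delta> es)"
      by (simp add: constacyclic_code_check_def words_def c_def distrib_right dvd_add dvd_smult)
    hence "(\<Sum>i<n. x i * c i) = 0"
      using x by (simp add: dual_code_def)
    hence "0 = emb (\<Sum>i<n. x i * c i)"
      by simp
    also have "\<dots> = (\<Sum>i<n. emb (x i) * ?w i)"
      by (simp add: emb_sum c_def c0)
    also have "\<dots> = a * s + frob (frob a) * frob (frob s)"
      by (simp add: distrib_left sum.distrib frob_power word_eval_scale_sum s_def frob2_word_eval)
    finally show ?thesis
      by simp
  qed
  \<comment> \<open>As a polynomial in \<open>a\<close> the trace of \<open>a * s\<close> has degree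
    q^2 < q^4, so it is not zero everywhere.\<close>
  have "1 < q ^ 2" "q ^ 2 < CARD('b)"
    using q_gt2 one_less_power[of q 2] by (simp_all add: card_field)
  then obtain a where "frob (frob s) * a ^ (q ^ 2) + s * a \<noteq> 0"
    using exists_not_root_binomial[of "frob (frob s)" "q ^ 2" UNIV s] \<open>s \<noteq> 0\<close> by auto
  thus False
    using orth[of a] by (simp add: frob2_power[symmetric] mult.commute add.commute)
qed

end

section \<open>Descent to the elliptic quadric\<close>

context subfield_embedding
begin

text \<open>The two parity checks \<open>\<alpha>\<^sub>i\<close> and \<open>\<alpha>\<^sub>i ^ e\<close> of the dual become, after rescaling coordinate \<open>i\<close> by
  \<open>s i\<close>, a point \<open>\<beta>\<^sub>i\<close> and its image under an odd power \<open>\<tau>\<close> of the Frobenius.\<close>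

lemma dual_code_optimal:
  fixes \<alpha> :: "'b" and s :: "nat \<Rightarrow> 'b" and \<tau> \<tau>' :: "'b \<Rightarrow> 'b"
  defines "\<beta> \<equiv> \<lambda>i. s i * \<alpha> ^ i"
  assumes n_def: "n = q ^ 2 + 1"
    and D: "linear_code n D"
      "\<And>x. x \<in> D \<longleftrightarrow> x \<in> words n UNIV \<and> word_eval n x \<alpha> = 0 \<and> word_eval n x (\<alpha> ^ e) = 0"
    and \<alpha>: "\<alpha> \<noteq> 0"
    and s: "\<And>i. s i \<noteq> 0" "\<And>i. frob (frob (s i)) = s i"
    and \<tau>: "\<tau> = frob \<and> \<tau>' = (\<lambda>x. frob (frob (frob x))) \<or> \<tau> = (\<lambda>x. frob (frob (frob x))) \<and> \<tau>' = frob"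
    and twist: "\<And>i. s i * (\<alpha> ^ e) ^ i = \<tau> (\<beta> i)"
    and quadric: "\<And>i. Qf (\<beta> i) = 0"
    and distinct: "\<And>i j. i < n \<Longrightarrow> j < n \<Longrightarrow> (\<alpha> ^ e) ^ i * \<alpha> ^ j = (\<alpha> ^ e) ^ j * \<alpha> ^ i \<Longrightarrow> i = j"
  shows "distance_optimal n (code_dim D) (min_dist n D) (locality n D) \<and>
    dimension_optimal TYPE('a) n (code_dim D) (min_dist n D) (locality n D)"
proof -
  have \<tau>_hom: "\<tau> 0 = 0" "\<tau> (x * y) = \<tau> x * \<tau> y" "\<tau> (sum f A) = (\<Sum>i\<in>A. \<tau> (f i))"
    "\<tau>' (x * y) = \<tau>' x * \<tau>' y" "\<tau>' (sum f A) = (\<Sum>i\<in>A. \<tau>' (f i))" "\<tau>' (\<tau> x) = x" "\<tau>' 0 = 0"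
    for x y and f :: "nat \<Rightarrow> 'b" and A
    using \<tau> by (auto simp: frob_sum)
  have \<tau>_Fq: "\<tau> t = t" if "t \<in> Fq" for t
    using \<tau> that by (auto simp: frob_Fq)
  \<comment> \<open>Odd powers of the Frobenius agree on GF(q^2).\<close>
  have \<tau>'_F: "\<tau>' z = frob z" if "frob (frob z) = z" for z
    using \<tau> that by auto

  interpret E: elliptic_quadric ty q \<beta> n
  proof unfold_locales
    show "n = q ^ 2 + 1"
      by (simp add: n_def)
    show "\<beta> i \<noteq> 0" for i
      using \<alpha> s by (simp add: \<beta>_def)
    show "Qf (\<beta> i) = 0" for i
      by (rule quadric)
    fix i j t assume ij: "i < n" "j < n" "t \<in> Fq" "\<beta> i = t * \<beta> j"
    \<comment> \<open>\<open>\<tau>\<close> fixes \<open>t\<close>, so proportional points share the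
      quotient of \<open>\<tau> (\<beta> i)\<close> by \<open>\<beta> i\<close>, from which
      \<open>s\<close> then cancels.\<close>
    have "\<tau> (\<beta> i) * \<beta> j = \<tau> (\<beta> j) * \<beta> i"
      using ij by (simp add: \<tau>_hom \<tau>_Fq)
    hence "s i * (\<alpha> ^ e) ^ i * \<beta> j = s j * (\<alpha> ^ e) ^ j * \<beta> i"
      by (simp only: twist)
    hence "(s i * s j) * ((\<alpha> ^ e) ^ i * \<alpha> ^ j) = (s i * s j) * ((\<alpha> ^ e) ^ j * \<alpha> ^ i)"
      by (simp add: \<beta>_def mult_ac)
    hence "(\<alpha> ^ e) ^ i * \<alpha> ^ j = (\<alpha> ^ e) ^ j * \<alpha> ^ i"
      using s(1) by simp
    thus "i = j"
      using distinct ij by blast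
  qed

  interpret Q: quadric_descent ty q \<beta> n D
  proof unfold_locales
    show "linear_code n D"
      by (rule D(1))
    show "CARD('a) = q ^ 2"
      by (rule card_subfield)
    have "finite D"
      using D(1) finite_words finite_subset by (auto simp: linear_code_def)
    \<comment> \<open>The pair of checks takes at most q^8 values, which is the fourth power of the
      size of GF(q^2).\<close>
    have "card (words n (UNIV :: 'a set)) \<le> card D * card (UNIV :: ('b \<times> 'b) set)"
    proof (rule card_le_kernel[where f = "\<lambda>x. (word_eval n x \<alpha>, word_eval n x (\<alpha> ^ e))"])
      fix x y :: "nat \<Rightarrow> 'a"
      assume *: "x \<in> words n UNIV" "y \<in> words n UNIV"
        "(word_eval n x \<alpha>, word_eval n x (\<alpha> ^ e)) = (word_eval n y \<alpha>, word_eval n y (\<alpha> ^ e))"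
      have "word_eval n (x - y) a = word_eval n x a - word_eval n y a" for a
        by (simp add: word_eval_diff)
      thus "x - y \<in> D"
        using * unfolding D(2) by (auto simp: words_def)
    qed (use \<open>finite D\<close> in auto)
    also have "card (UNIV :: ('b \<times> 'b) set) = CARD('a) ^ 4"
      by (simp add: card_prod card_field card_subfield flip: power_add power_mult)
    finally show "CARD('a) ^ n \<le> card D * CARD('a) ^ 4"
      by (simp add: card_words)
  next
    fix y assume y: "y \<in> E.quadric_code"
    have yF: "y i \<in> Fq" for i
      using y by (cases "i < n") (auto simp: E.quadric_code_def words_def)
    have "\<forall>i. \<exists>c. emb c = s i * y i"
      using range_emb_iff s(2) frob_Fq[OF yF] by (metis frob_mult imageE)
    then obtain x where x: "\<And>i. emb (x i) = s i * y i"
      by metis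
    have zero: "x i = 0 \<longleftrightarrow> y i = 0" for i
      using x[of i] s(1)[of i] by (metis emb_eq_0_iff mult_eq_0_iff)
    have sum0: "(\<Sum>i<n. y i * \<beta> i) = 0"
      using y by (simp add: E.quadric_code_def)
    have "word_eval n x \<alpha> = (\<Sum>i<n. y i * \<beta> i)"
      by (simp add: word_eval_def x \<beta>_def mult_ac)
    moreover have "word_eval n x (\<alpha> ^ e) = \<tau> (\<Sum>i<n. y i * \<beta> i)"
      unfolding \<tau>_hom word_eval_def x twist[symmetric] \<tau>_Fq[OF yF] by (simp only: mult_ac)
    ultimately have "x \<in> D"
      unfolding D(2) sum0 using zero y by (auto simp: \<tau>_hom E.quadric_code_def words_def)
    thus "\<exists>x\<in>D. \<forall>i. (x i = 0) = (y i = 0)"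
      using zero by blast
  next
    fix x i0 assume x: "x \<in> D" "x i0 \<noteq> 0"
    \<comment> \<open>Undoing the scaling gives a relation among the \<open>\<beta> i\<close>;
      applying \<open>\<tau>'\<close> to the second check gives the same relation with
      \<open>frob (z i)\<close>. So every trace of \<open>c * z i\<close> to \<open>Fq\<close> is a
      word, and \<open>c\<close> keeps entry \<open>i0\<close> nonzero.\<close>
    define z where "z i = emb (x i) / s i" for i
    have z: "frob (frob (z i)) = z i" for i
      by (simp add: z_def s)
    have sz: "s i * z i = emb (x i)" for i
      using s(1) by (simp add: z_def)
    have "(\<Sum>i<n. z i * \<beta> i) = word_eval n x \<alpha>"
      by (simp add: word_eval_def \<beta>_def mult_ac flip: sz)
    hence sum1: "(\<Sum>i<n. z i * \<beta> i) = 0"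
      using x D(2) by simp
    have "(\<Sum>i<n. z i * \<tau> (\<beta> i)) = word_eval n x (\<alpha> ^ e)"
      by (simp add: word_eval_def mult_ac flip: twist sz)
    hence "\<tau>' (\<Sum>i<n. z i * \<tau> (\<beta> i)) = 0"
      using x D(2) by (simp add: \<tau>_hom)
    hence sum2: "(\<Sum>i<n. frob (z i) * \<beta> i) = 0"
      unfolding \<tau>_hom \<tau>'_F[OF z] .
    have "frob (z i0) \<noteq> 0"
      using x s by (simp add: z_def)
    then obtain c where c: "frob (frob c) = c" "frob (z i0) * frob c + z i0 * c \<noteq> 0"
      by (rule exists_twisted_trace_nonzero)
    define y where "y i = frob (z i) * frob c + z i * c" for i
    have "(\<Sum>i<n. y i * \<beta> i) = frob c * (\<Sum>i<n. frob (z i) * \<beta> i) + c * (\<Sum>i<n. z i * \<beta> i)"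
      by (simp add: y_def sum_distrib_left sum.distrib[symmetric] algebra_simps)
    hence "(\<Sum>i<n. y i * \<beta> i) = 0"
      by (simp add: sum1 sum2)
    moreover have "y i \<in> Fq" for i
      by (simp add: Fq_def y_def z c add.commute)
    moreover have zero: "x i = 0 \<Longrightarrow> y i = 0" for i
      by (simp add: y_def z_def)
    moreover have "x i = 0" if "n \<le> i" for i
      using x(1) that D(2) by (simp add: words_def)
    ultimately have "y \<in> E.quadric_code"
      by (simp add: E.quadric_code_def words_def)
    moreover have "y i0 \<noteq> 0"
      using c(2) by (simp add: y_def)
    ultimately show "\<exists>y\<in>E.quadric_code. y i0 \<noteq> 0 \<and> (\<forall>j. x j = 0 \<longrightarrow> y j = 0)"
      using zero by blast
  qed

  show ?thesis
    by (rule Q.distance_and_dimension_optimal)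
qed

end

theorem theorem4p12:
  fixes p m q r :: nat
    and lam :: "'a::{field,finite}"
    and \<delta> :: "'b::{field,finite}"
    and emb :: "'a \<Rightarrow> 'b"
    and es :: "nat list"
  assumes "prime p" and "m > 0" and "q = p ^ m" and "q > 2"
    and "CARD('a) = q ^ 2" and "CARD('b) = q ^ 4" and "field_emb emb"
    and "has_order lam r"
    and "has_order \<delta> (r * (q ^ 2 + 1))" and "\<delta> ^ (q ^ 2 + 1) = emb lam"
    and "(r dvd q + 1 \<and> multiplicity 2 r = multiplicity 2 (q + 1) \<and>
            es = [1, q ^ 2, q ^ 2 + q + 1, q ^ 4 + q ^ 3 + q ^ 2])
       \<or> (r dvd q - 1 \<and> multiplicity 2 r = multiplicity 2 (q - 1) \<and>
            es = [1, q ^ 2, q ^ 2 - q + 1, q ^ 4 - q ^ 3 + q ^ 2])"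
  shows
    "let n = q ^ 2 + 1;
         D = dual_code n (constacyclic_code_check emb n lam (check_poly \<delta> es));
         k = code_dim D; d = min_dist n D; rl = locality n D
     in distance_optimal n k d rl \<and> dimension_optimal TYPE('a) n k d rl"
proof -
  define n where "n = q ^ 2 + 1"
  define D where "D = dual_code n (constacyclic_code_check emb n lam (check_poly \<delta> es))"
  have char: "CHAR('b) = p"
    using assms by (intro CHAR_finite_field[of p "m * 4"]) (simp_all add: power_mult)
  interpret subfield_embedding "TYPE('b)" q emb
  proof unfold_locales
    show "(x + y) ^ q = x ^ q + y ^ q" for x y :: 'b
      using assms char by (intro freshmans_dream'[where n = m]) auto
  qed (use assms in auto)

  \<comment> \<open>Both cases are treated at once through \<open>e = q * w + 1\<close>.\<close>
  obtain w e where w: "w = q + 1 \<and> e = q ^ 2 + q + 1 \<or> w = q - 1 \<and> e = q ^ 2 - q + 1"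
    and rw: "r dvd w" "multiplicity 2 r = multiplicity 2 w" and es: "es = [1, q ^ 2, e, e * q ^ 2]"
    using assms(11)
  proof
    assume "r dvd q + 1 \<and> multiplicity 2 r = multiplicity 2 (q + 1) \<and>
      es = [1, q ^ 2, q ^ 2 + q + 1, q ^ 4 + q ^ 3 + q ^ 2]"
    thus thesis
      using that[of "q + 1" "q ^ 2 + q + 1"] by (simp add: algebra_simps power_numeral_reduce)
  next
    assume "r dvd q - 1 \<and> multiplicity 2 r = multiplicity 2 (q - 1) \<and>
      es = [1, q ^ 2, q ^ 2 - q + 1, q ^ 4 - q ^ 3 + q ^ 2]"
    thus thesis
      using that[of "q - 1" "q ^ 2 - q + 1"]
      by (simp add: algebra_simps power_numeral_reduce diff_mult_distrib2)
  qed
  have e: "e = q * w + 1"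
    using w by (auto simp: power2_eq_square algebra_simps diff_mult_distrib2)

  have \<delta>n: "\<delta> ^ n = emb lam"
    using assms(10) by (simp add: n_def)
  have \<delta>0: "\<delta> \<noteq> 0"
  proof
    assume "\<delta> = 0"
    moreover have "0 < r * (q ^ 2 + 1)" "\<delta> ^ (r * (q ^ 2 + 1)) = 1"
      using assms(9) by (auto simp: has_order_def)
    ultimately show False
      by (auto simp: power_0_left split: if_splits)
  qed
  have lam_w: "lam ^ w = 1"
    using rw(1) assms(8) by (auto simp: has_order_def power_mult elim!: dvdE)
  have "lam ^ e = lam"
    by (simp add: e power_mult mult.commute[of q] lam_w)
  hence \<delta>en: "(\<delta> ^ e) ^ n = emb lam"
    using \<delta>n by (metis emb_power mult.commute power_mult)

  \<comment> \<open>The dual is evaluated at inverses of roots; \<open>\<mu>\<close> is the norm of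
    \<open>\<alpha>\<close> to GF(q^2), the inverse of \<open>emb lam\<close>.\<close>
  define \<alpha> where "\<alpha> = inverse \<delta>"
  define \<mu> where "\<mu> = \<alpha> * frob (frob \<alpha>)"
  have \<alpha>0: "\<alpha> \<noteq> 0"
    using \<delta>0 by (simp add: \<alpha>_def)
  have \<alpha>n: "\<alpha> ^ n = \<mu>"
    by (simp add: \<mu>_def n_def frob2_power)
  hence \<mu>_eq: "\<mu> = inverse (emb lam)"
    using \<delta>n by (simp add: \<alpha>_def power_inverse)
  have \<mu>_w: "\<mu> ^ w = 1"
    by (simp add: \<mu>_eq power_inverse lam_w flip: emb_power)
  have frob2_\<mu>: "frob (frob \<mu>) = \<mu>"
    by (simp add: \<mu>_eq)
  have norm_power: "\<alpha> ^ i * frob (frob (\<alpha> ^ i)) = \<mu> ^ i" for i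
    by (simp add: \<mu>_def frob_power power_mult_distrib)

  have mem_D: "x \<in> D \<longleftrightarrow> x \<in> words n UNIV \<and> word_eval n x \<alpha> = 0 \<and> word_eval n x (\<alpha> ^ e) = 0" for x
  proof (intro iffI conjI; (elim conjE)?)
    assume x: "x \<in> D"
    show "x \<in> words n UNIV"
      using x by (simp add: D_def dual_code_def)
    show "word_eval n x \<alpha> = 0"
      using word_eval_0_if_mem_dual[of x n lam \<delta> es 1] x \<delta>n \<delta>0 by (simp add: es D_def \<alpha>_def)
    show "word_eval n x (\<alpha> ^ e) = 0"
      using word_eval_0_if_mem_dual[of x n lam \<delta> es e] x \<delta>en \<delta>0
      by (simp add: es D_def \<alpha>_def power_inverse)
  next
    assume x: "x \<in> words n UNIV" "word_eval n x \<alpha> = 0" "word_eval n x (\<alpha> ^ e) = 0"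
    show "x \<in> D"
      unfolding D_def
    proof (rule mem_dual_if_word_eval_0[where \<omega> = "\<delta> ^ r"])
      show "(\<delta> ^ r) ^ n = 1"
        using assms(9) unfolding has_order_def n_def power_mult[symmetric] by blast
      show "(\<delta> ^ r) ^ j \<noteq> 1" if "0 < j" "j < n" for j
      proof -
        have "0 < r"
          using assms(8) by (simp add: has_order_def)
        hence "0 < r * j" "r * j < r * n"
          using that by simp_all
        thus ?thesis
          using assms(9) unfolding has_order_def n_def power_mult[symmetric] by blast
      qed
      have "of_nat q = (0::'b)"
        using char assms(2,3) by (simp add: of_nat_eq_0_iff_char_dvd)
      thus "of_nat n \<noteq> (0::'b)"
        by (simp add: n_def)
      have conj: "word_eval n x (frob (frob a)) = 0" if "word_eval n x a = 0" for a
        using frob2_word_eval[of n x a] that by simp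
      show "word_eval n x (inverse (\<delta> ^ e')) = 0" if "e' \<in> set es" for e'
      proof -
        have "inverse (\<delta> ^ e') = \<alpha> ^ e'"
          by (simp add: \<alpha>_def power_inverse)
        moreover have "\<alpha> ^ (q ^ 2) = frob (frob \<alpha>)" "\<alpha> ^ (e * q ^ 2) = frob (frob (\<alpha> ^ e))"
          by (simp_all add: frob2_power power_mult)
        moreover have "e' = 1 \<or> e' = q ^ 2 \<or> e' = e \<or> e' = e * q ^ 2"
          using that by (simp add: es)
        ultimately show ?thesis
          using x(2,3) conj by (elim disjE) (simp_all only: power_one_right)
      qed
    qed (use x \<delta>n \<delta>0 in auto)
  qed

  \<comment> \<open>As \<open>e - 1 = q * w\<close>, the order of \<open>\<delta>\<close> divides
    \<open>q * w * (j - i)\<close>, so \<open>n\<close> divides \<open>j - i < n\<close>.\<close>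
  have distinct: "i = j"
    if "i < n" "j < n" "(\<alpha> ^ e) ^ i * \<alpha> ^ j = (\<alpha> ^ e) ^ j * \<alpha> ^ i" for i j
    using that
  proof (induction i j rule: linorder_wlog)
    case (le i j)
    have "\<alpha> ^ (i + j) * \<alpha> ^ (q * w * i) = \<alpha> ^ (i + j) * \<alpha> ^ (q * w * j)"
      using le(4) by (simp add: e algebra_simps flip: power_mult power_add)
    hence "\<alpha> ^ (q * w * i) = \<alpha> ^ (q * w * j)"
      using \<alpha>0 by simp
    also have "q * w * j = q * w * i + q * w * (j - i)"
      using le(1) by (simp flip: distrib_left)
    finally have "\<alpha> ^ (q * w * (j - i)) = 1"
      using \<alpha>0 by (simp add: power_add)
    hence "\<delta> ^ (q * w * (j - i)) = 1"
      by (simp add: \<alpha>_def power_inverse)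
    hence "r * (q ^ 2 + 1) dvd q * w * (j - i)"
      using has_order_imp_dvd assms(9) by blast
    hence "n dvd j - i"
      unfolding n_def using dvd_of_order_dvd[of q r w "j - i"] w rw assms(4) by auto
    hence "j - i = 0"
      using le(3) by (auto dest: dvd_imp_le)
    thus ?case
      using le(1) by simp
  qed metis

  have lin: "linear_code n D"
    unfolding D_def by (rule linear_code_dual)
  have "distance_optimal n (code_dim D) (min_dist n D) (locality n D) \<and>
    dimension_optimal TYPE('a) n (code_dim D) (min_dist n D) (locality n D)"
    using w
  proof
    assume "w = q + 1 \<and> e = q ^ 2 + q + 1"
    hence w': "w = q + 1" and e': "e = q + n"
      by (simp_all add: n_def)
    have \<mu>1: "frob \<mu> * \<mu> = 1"
      using \<mu>_w by (simp add: w' frob_def mult.commute)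
    \<comment> \<open>Hilbert 90: \<open>\<mu> ^ i\<close> has norm 1 over \<open>Fq\<close>, and
      \<open>s\<close> is the usual resolvent of some \<open>c\<close> that makes it
      nonzero.\<close>
    have "\<exists>s. s \<noteq> 0 \<and> frob (frob s) = s \<and> frob s = \<mu> ^ i * s" for i
    proof -
      have 1: "\<mu> ^ i * frob (\<mu> ^ i) = 1"
        using \<mu>1 by (simp add: frob_power mult.commute flip: power_mult_distrib)
      hence "frob (\<mu> ^ i) \<noteq> 0"
        by (metis mult_zero_right zero_neq_one)
      then obtain c where c: "frob (frob c) = c" "frob (\<mu> ^ i) * frob c + 1 * c \<noteq> 0"
        by (rule exists_twisted_trace_nonzero)
      define s where "s = frob (\<mu> ^ i) * frob c + c"
      have F: "frob (frob (\<mu> ^ i)) = \<mu> ^ i"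
        using frob2_\<mu> by (simp add: frob_power)
      have "\<mu> ^ i * s = (\<mu> ^ i * frob (\<mu> ^ i)) * frob c + \<mu> ^ i * c"
        by (simp add: s_def algebra_simps)
      moreover have "frob s = \<mu> ^ i * c + frob c"
        by (simp only: s_def frob_add frob_mult F c(1))
      moreover have "frob (frob s) = s"
        by (simp only: s_def frob_add frob_mult F c(1))
      ultimately show ?thesis
        using c(2) 1 by (intro exI[of _ s]) (simp add: s_def add.commute)
    qed
    then obtain s where s: "\<And>i. s i \<noteq> 0" "\<And>i. frob (frob (s i)) = s i" "\<And>i. frob (s i) = \<mu> ^ i * s i"
      by metis
    have \<alpha>e: "\<alpha> ^ e = frob \<alpha> * \<mu>"
      by (simp add: e' power_add \<alpha>n frob_def)
    have twist: "s i * (\<alpha> ^ e) ^ i = frob (s i * \<alpha> ^ i)" for i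
      by (simp add: \<alpha>e s(3) frob_power power_mult_distrib)
    \<comment> \<open>The norm to GF(q^2) is \<open>s i * s i * \<mu> ^ i\<close>, fixed by
      \<open>frob\<close> because of \<open>s(3)\<close> and \<open>\<mu>1\<close>.\<close>
    have quadric: "Qf (s i * \<alpha> ^ i) = 0" for i
    proof -
      have N: "(s i * \<alpha> ^ i) * frob (frob (s i * \<alpha> ^ i)) = s i * s i * \<mu> ^ i"
        using norm_power[of i] s(2)[of i] by (simp add: mult_ac)
      have "frob (s i * s i * \<mu> ^ i) = s i * s i * \<mu> ^ i * (frob \<mu> * \<mu>) ^ i"
        by (simp add: s(3) frob_power power_mult_distrib mult_ac)
      also have "\<dots> = s i * s i * \<mu> ^ i"
        by (simp only: \<mu>1 power_one mult_1_right)
      finally show ?thesis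
        unfolding Qf_def frob_mult[symmetric] N by simp
    qed
    show ?thesis
    proof (rule dual_code_optimal[OF n_def lin mem_D \<alpha>0 s(1,2) _ twist quadric distinct])
      show "frob = frob \<and> (\<lambda>x. frob (frob (frob x))) = (\<lambda>x. frob (frob (frob x)))
          \<or> frob = (\<lambda>x. frob (frob (frob x))) \<and> (\<lambda>x. frob (frob (frob x))) = frob"
        by simp
    qed
  next
    assume "w = q - 1 \<and> e = q ^ 2 - q + 1"
    moreover have "q \<le> q ^ 2"
      by (simp add: power2_eq_square)
    ultimately have w': "w = q - 1" and e': "e + q = n"
      by (simp_all add: n_def)
    \<comment> \<open>Here \<open>\<mu>\<close> already lies in \<open>Fq\<close>, so
      \<open>\<alpha> ^ e\<close>, the quotient of \<open>\<mu>\<close> by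
      \<open>frob \<alpha>\<close>, is itself the third Frobenius image of \<open>\<alpha>\<close>,
      and all scaling factors can be 1.\<close>
    have \<mu>1: "frob \<mu> = \<mu>"
      using \<mu>_w assms(4) by (simp add: w' frob_def power_eq_if)
    have "\<alpha> ^ e * frob \<alpha> = \<mu>"
      by (simp add: frob_def e' \<alpha>n flip: power_add)
    also have "\<mu> = frob (frob (frob \<alpha>)) * frob \<alpha>"
      using \<mu>1 by (simp add: \<mu>_def mult.commute)
    finally have \<alpha>e: "\<alpha> ^ e = frob (frob (frob \<alpha>))"
      using \<alpha>0 by simp
    have quadric: "Qf (1 * \<alpha> ^ i) = 0" for i
      unfolding Qf_def frob_mult[symmetric] mult_1_left norm_power using \<mu>1 by (simp add: frob_power)
    have twist: "1 * (\<alpha> ^ e) ^ i = frob (frob (frob (1 * \<alpha> ^ i)))" for i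
      by (simp add: \<alpha>e frob_power)
    show ?thesis
    proof (rule dual_code_optimal[OF n_def lin mem_D \<alpha>0 _ _ _ twist quadric distinct])
      show "(\<lambda>x. frob (frob (frob x))) = frob \<and> frob = (\<lambda>x. frob (frob (frob x)))
          \<or> (\<lambda>x. frob (frob (frob x))) = (\<lambda>x. frob (frob (frob x))) \<and> frob = frob"
        by simp
    qed simp_all
  qed
  thus ?thesis
    by (simp add: Let_def n_def D_def)
qed

end
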